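(* Let $k$ be a field (algebraically closed of characteristic $0$), $R=k[x_1,\dots,x_d]$, $\mathfrak m=(x_1,\dots,x_d)$, fix any term order on $R$, and let $I$ be an $\mathfrak m$-primary ideal of $R$ with initial ideal $\operatorname{in}(I)$. Then: (1) $\operatorname{HF}_I(n)\le\operatorname{HF}_{\operatorname{in}(I)}(n)$ for all $n\gg0$; (2) if $\operatorname{depth}\operatorname{gr}_{\operatorname{in}(I)}(R)>0$, then $\operatorname{HF}_I(n)\le\operatorname{HF}_{\operatorname{in}(I)}(n)$ for every $n\ge0$.
   Context: For an $\mathfrak m$-primary ideal $J$, $\operatorname{HF}_J(n)=\lambda(J^n/J^{n+1})$ (length as $R$-module), and $\operatorname{gr}_J(R)=\bigoplus_{n\ge0}J^n/J^{n+1}$. *)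

theory Defs
  imports "HOL-Library.Poly_Mapping" "HOL-Library.Extended_Nat"
          "HOL-Computational_Algebra.Polynomial"
begin

text \<open>Polynomial ring R = k[x_v | v in 'v] over a finite variable type 'v (d = CARD('v)).
  Monomials are exponent vectors 'v =>0 nat, polynomials are finitely supported
  coefficient functions on monomials.\<close>

type_synonym ('v, 'k) mpoly = "('v \<Rightarrow>\<^sub>0 nat) \<Rightarrow>\<^sub>0 'k"

definition is_ideal :: "'a::comm_ring_1 set \<Rightarrow> bool" where
  "is_ideal I \<longleftrightarrow> 0 \<in> I \<and> (\<forall>a\<in>I. \<forall>b\<in>I. a + b \<in> I) \<and> (\<forall>r a. a \<in> I \<longrightarrow> r * a \<in> I)"

definition ideal_gen :: "'a::comm_ring_1 set \<Rightarrow> 'a set" where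
  "ideal_gen S = \<Inter> {J. is_ideal J \<and> S \<subseteq> J}"

fun ideal_pow :: "'a::comm_ring_1 set \<Rightarrow> nat \<Rightarrow> 'a set" where
  "ideal_pow J 0 = UNIV"
| "ideal_pow J (Suc n) = ideal_gen {a * b | a b. a \<in> J \<and> b \<in> ideal_pow J n}"

definition ideal_radical :: "'a::comm_ring_1 set \<Rightarrow> 'a set" where
  "ideal_radical I = {f. \<exists>n. f ^ n \<in> I}"

definition primary_ideal :: "'a::comm_ring_1 set \<Rightarrow> bool" where
  "primary_ideal I \<longleftrightarrow> is_ideal I \<and> I \<noteq> UNIV \<and>
     (\<forall>a b. a * b \<in> I \<longrightarrow> a \<notin> I \<longrightarrow> b \<in> ideal_radical I)"

definition var :: "'v \<Rightarrow> ('v, 'k::comm_ring_1) mpoly" where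
  "var v = Poly_Mapping.single (Poly_Mapping.single v 1) 1"

definition max_ideal :: "('v, 'k::comm_ring_1) mpoly set" where
  "max_ideal = ideal_gen (range var)"

definition m_primary :: "('v, 'k::comm_ring_1) mpoly set \<Rightarrow> bool" where
  "m_primary I \<longleftrightarrow> primary_ideal I \<and> ideal_radical I = max_ideal"

definition term_order :: "(('v \<Rightarrow>\<^sub>0 nat) \<Rightarrow> ('v \<Rightarrow>\<^sub>0 nat) \<Rightarrow> bool) \<Rightarrow> bool" where
  "term_order le \<longleftrightarrow>
     (\<forall>a. le a a) \<and> (\<forall>a b. le a b \<longrightarrow> le b a \<longrightarrow> a = b) \<and>
     (\<forall>a b c. le a b \<longrightarrow> le b c \<longrightarrow> le a c) \<and> (\<forall>a b. le a b \<or> le b a) \<and>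
     (\<forall>a. le 0 a) \<and> (\<forall>a b c. le a b \<longrightarrow> le (a + c) (b + c))"

definition lead_monom :: "(('v \<Rightarrow>\<^sub>0 nat) \<Rightarrow> ('v \<Rightarrow>\<^sub>0 nat) \<Rightarrow> bool) \<Rightarrow> ('v, 'k::zero) mpoly \<Rightarrow> ('v \<Rightarrow>\<^sub>0 nat)" where
  "lead_monom le f = (THE m. m \<in> Poly_Mapping.keys f \<and> (\<forall>m' \<in> Poly_Mapping.keys f. le m' m))"

definition initial_ideal :: "(('v \<Rightarrow>\<^sub>0 nat) \<Rightarrow> ('v \<Rightarrow>\<^sub>0 nat) \<Rightarrow> bool) \<Rightarrow> ('v, 'k::comm_ring_1) mpoly set \<Rightarrow> ('v, 'k) mpoly set" where
  "initial_ideal le I = ideal_gen {Poly_Mapping.single (lead_monom le f) 1 | f. f \<in> I \<and> f \<noteq> 0}"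

text \<open>HF_J(n) = length of the R-module J^n/J^(n+1): the supremum of the lengths of strict
  chains of R-submodules, i.e. of ideals J^(n+1) = N_0 < N_1 < ... < N_l = J^n.\<close>
definition HF :: "'a::comm_ring_1 set \<Rightarrow> nat \<Rightarrow> enat" where
  "HF J n = Sup {enat l | l. \<exists>N :: nat \<Rightarrow> 'a set.
      N 0 = ideal_pow J (Suc n) \<and> N l = ideal_pow J n \<and> (\<forall>i\<le>l. is_ideal (N i)) \<and>
      (\<forall>i<l. N i \<subset> N (Suc i))}"

text \<open>Associated graded ring gr_J(R) = (+)_n J^n/J^(n+1).  An element is represented by a
  family f with f n in J^n and f n = 0 for almost all n; it is zero in gr iff f n in J^(n+1)
  for all n; the product is (f*g)_n = sum_{i+j=n} f_i g_j.\<close>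
definition gr_rep :: "'a::comm_ring_1 set \<Rightarrow> (nat \<Rightarrow> 'a) \<Rightarrow> bool" where
  "gr_rep J f \<longleftrightarrow> (\<forall>n. f n \<in> ideal_pow J n) \<and> finite {n. f n \<noteq> 0}"

definition gr_zero :: "'a::comm_ring_1 set \<Rightarrow> (nat \<Rightarrow> 'a) \<Rightarrow> bool" where
  "gr_zero J f \<longleftrightarrow> (\<forall>n. f n \<in> ideal_pow J (Suc n))"

definition gr_mult :: "(nat \<Rightarrow> 'a::comm_ring_1) \<Rightarrow> (nat \<Rightarrow> 'a) \<Rightarrow> nat \<Rightarrow> 'a" where
  "gr_mult f g n = (\<Sum>i\<le>n. f i * g (n - i))"

text \<open>The homogeneous maximal ideal of gr_J(R): (m/J) (+) (+)_{n>=1} J^n/J^(n+1).\<close>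
definition gr_max_ideal_elem :: "('v, 'k::comm_ring_1) mpoly set \<Rightarrow> (nat \<Rightarrow> ('v, 'k) mpoly) \<Rightarrow> bool" where
  "gr_max_ideal_elem J f \<longleftrightarrow> gr_rep J f \<and> f 0 \<in> max_ideal"

definition gr_depth_pos :: "('v, 'k::comm_ring_1) mpoly set \<Rightarrow> bool" where
  "gr_depth_pos J \<longleftrightarrow> (\<exists>f. gr_max_ideal_elem J f \<and>
      (\<forall>g. gr_rep J g \<longrightarrow> gr_zero J (gr_mult f g) \<longrightarrow> gr_zero J g))"

end

theory Submission
  imports Defs "HOL-Library.List_Lexorder" "HOL-Library.Product_Lexorder"
begin

text \<open>
  Write \<open>J = in(I)\<close>. For subspaces \<open>A \<subseteq> B\<close> of finite codimension, \<open>dim B/A\<close> is the number of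
  leading monomials of \<open>B\<close> that are not leading monomials of \<open>A\<close>. Since \<open>J\<^sup>n \<subseteq> in(I\<^sup>n)\<close>, the
  number \<open>q(n) = \<lambda>(R/J\<^sup>n) - \<lambda>(R/I\<^sup>n) = dim in(I\<^sup>n)/J\<^sup>n\<close> is nonnegative, and the claim
  \<open>HF\<^sub>I(n) \<le> HF\<^sub>J(n)\<close> says \<open>q(n) \<le> q(n + 1)\<close>.

  Both Hilbert functions are eventually polynomial, so the sign of \<open>q(n + 1) - q(n)\<close> is
  eventually constant; it cannot be negative because \<open>q \<ge> 0\<close>.

  If \<open>gr\<^sub>J(R)\<close> has positive depth, the sum \<open>f\<close> of a finite set of monomial generators of \<open>J\<close>
  satisfies \<open>(J\<^sup>n\<^sup>+\<^sup>1 : f) = J\<^sup>n\<close> for all \<open>n\<close>. As \<open>f in(I\<^sup>n) \<subseteq> in(I\<^sup>n\<^sup>+\<^sup>1)\<close>, multiplication by \<open>f\<close>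
  embeds \<open>in(I\<^sup>n)/J\<^sup>n\<close> into \<open>in(I\<^sup>n\<^sup>+\<^sup>1)/J\<^sup>n\<^sup>+\<^sup>1\<close>.
\<close>

section \<open>Ideals, powers and monomial spans\<close>

text \<open>\<open>HF\<close> is a supremum over chains of ideals, whereas leading monomials count
  dimensions over \<open>k\<close>. The two agree because a strict inclusion of ideals of finite
  codimension can be refined by adjoining socle elements, each of which raises the dimension by one.
  Finite codimension also makes reduction by leading terms terminate: it runs inside the finite set
  of monomials outside the smaller space.

  Eventual polynomiality uses the same linear algebra. A lexicographic order on the exponents of
  generators turns the dimension of I^n/I^(n+1) into the count of the complement of an upset, which
  is treated by induction on the number of variables.

  In the depth part, the obstacle is that the regular element of \<open>gr\<close> is an arbitrary
  family, not one polynomial. It first yields only a colon statement for all of J: if u J lies in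
  J^(n+1) for a monomial u, then u lies in J^n. Passing from J to a single element would usually
  call for a generic combination of generators; for a monomial ideal the plain sum works, because a
  term order separates its summands.\<close>

abbreviation "keys \<equiv> Poly_Mapping.keys"
abbreviation "lookup \<equiv> Poly_Mapping.lookup"
abbreviation mon :: "('v \<Rightarrow>\<^sub>0 nat) \<Rightarrow> ('v, 'k::comm_ring_1) mpoly"
  where "mon m \<equiv> Poly_Mapping.single m 1"
abbreviation cst :: "'k::comm_ring_1 \<Rightarrow> ('v, 'k) mpoly"
  where "cst c \<equiv> Poly_Mapping.single 0 c"

lemma is_ideal_ideal_gen: "is_ideal (ideal_gen S)"
  by (auto simp: is_ideal_def ideal_gen_def)

lemma ideal_gen_superset: "S \<subseteq> ideal_gen S"
  by (auto simp: ideal_gen_def)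

lemma ideal_gen_minimal: "is_ideal J \<Longrightarrow> S \<subseteq> J \<Longrightarrow> ideal_gen S \<subseteq> J"
  by (auto simp: ideal_gen_def)

lemma is_idealD:
  assumes "is_ideal I"
  shows "0 \<in> I" "a \<in> I \<Longrightarrow> b \<in> I \<Longrightarrow> a + b \<in> I" "a \<in> I \<Longrightarrow> r * a \<in> I" "a \<in> I \<Longrightarrow> a * r \<in> I"
    "a \<in> I \<Longrightarrow> b \<in> I \<Longrightarrow> a - b \<in> I"
proof -
  show "0 \<in> I" and add: "\<And>a b. a \<in> I \<Longrightarrow> b \<in> I \<Longrightarrow> a + b \<in> I"
    and mult: "\<And>r a. a \<in> I \<Longrightarrow> r * a \<in> I"
    using assms by (auto simp: is_ideal_def)
  then show "\<And>a r. a \<in> I \<Longrightarrow> a * r \<in> I"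
    by (metis mult.commute)
  show "a - b \<in> I" if "a \<in> I" "b \<in> I" for a b
    using add[OF that(1) mult[OF that(2), of "-1"]] by simp
qed

lemma is_ideal_sum: "is_ideal I \<Longrightarrow> (\<And>x. x \<in> X \<Longrightarrow> f x \<in> I) \<Longrightarrow> sum f X \<in> I"
  by (induction X rule: infinite_finite_induct) (auto simp: is_ideal_def)

lemma is_ideal_colon: "is_ideal K \<Longrightarrow> is_ideal {a. \<forall>b\<in>T. a * b \<in> K}"
  by (auto simp: is_ideal_def distrib_right mult.assoc)

text \<open>The elements that multiply a fixed set into \<open>K\<close> form an ideal, so
  generators can be tested first in one factor and then in the other.\<close>

lemma ideal_gen_mult_subset:
  assumes "is_ideal K" "\<And>a b. a \<in> S \<Longrightarrow> b \<in> T \<Longrightarrow> a * b \<in> K"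
    and "a \<in> ideal_gen S" "b \<in> ideal_gen T"
  shows "a * b \<in> K"
proof -
  have *: "ideal_gen S \<subseteq> {a. \<forall>b\<in>T. a * b \<in> K}"
    using assms(1,2) by (intro ideal_gen_minimal is_ideal_colon) auto
  have "b * a \<in> K" if "a \<in> ideal_gen S" "b \<in> T" for a b
    using * that by (metis (no_types, lifting) mem_Collect_eq mult.commute subsetD)
  then have "ideal_gen T \<subseteq> {b. \<forall>a\<in>ideal_gen S. b * a \<in> K}"
    using assms(1) by (intro ideal_gen_minimal is_ideal_colon) auto
  then have "b * a \<in> K"
    using assms(3,4) by blast
  then show ?thesis by (simp add: mult.commute)
qed

lemma is_ideal_ideal_pow: "is_ideal (ideal_pow J n)"
  by (cases n) (auto simp: is_ideal_ideal_gen, simp add: is_ideal_def)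

lemma ideal_pow_Suc_mult: "a \<in> J \<Longrightarrow> b \<in> ideal_pow J n \<Longrightarrow> a * b \<in> ideal_pow J (Suc n)"
  unfolding ideal_pow.simps by (rule subsetD[OF ideal_gen_superset]) blast

lemma ideal_pow_Suc_subset: "ideal_pow J (Suc n) \<subseteq> ideal_pow J n"
  unfolding ideal_pow.simps
  by (intro ideal_gen_minimal is_ideal_ideal_pow) (auto intro: is_idealD(3)[OF is_ideal_ideal_pow])

lemma power_in_ideal_pow: "a \<in> J \<Longrightarrow> a ^ n \<in> ideal_pow J n"
proof (induction n)
  case (Suc n)
  then show ?case using ideal_pow_Suc_mult[of a J "a ^ n" n] by simp
qed simp

lemma ideal_pow_mult: "a \<in> ideal_pow J m \<Longrightarrow> b \<in> ideal_pow J n \<Longrightarrow> a * b \<in> ideal_pow J (m + n)"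
proof (induction m arbitrary: a b)
  case 0
  then show ?case by (simp add: is_idealD(3) is_ideal_ideal_pow)
next
  case (Suc m)
  have "ideal_pow J (Suc m) \<subseteq> {a. \<forall>b\<in>ideal_pow J n. a * b \<in> ideal_pow J (Suc m + n)}"
    unfolding ideal_pow.simps(2)[of J m]
  proof (intro ideal_gen_minimal is_ideal_colon is_ideal_ideal_pow subsetI CollectI ballI)
    fix x b assume "x \<in> {a * b |a b. a \<in> J \<and> b \<in> ideal_pow J m}" and b: "b \<in> ideal_pow J n"
    then obtain c d where x: "x = c * d" "c \<in> J" "d \<in> ideal_pow J m" by auto
    have "c * (d * b) \<in> ideal_pow J (Suc (m + n))"
      by (rule ideal_pow_Suc_mult[OF x(2) Suc.IH[OF x(3) b]])
    then show "x * b \<in> ideal_pow J (Suc m + n)" by (simp add: x mult.assoc)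
  qed
  then show ?case using Suc.prems by blast
qed

lemma lookup_single_mult:
  fixes f :: "('v, 'k::comm_ring_1) mpoly"
  shows "lookup (Poly_Mapping.single a c * f) (a + m) = c * lookup f m"
proof -
  define f' where "f' = f - Poly_Mapping.single m (lookup f m)"
  have f: "f = Poly_Mapping.single m (lookup f m) + f'" by (simp add: f'_def)
  have "m \<notin> keys f'"
    by (simp add: f'_def in_keys_iff lookup_minus)
  then have "a + m \<notin> keys (Poly_Mapping.single a c * f')"
    using keys_mult[of "Poly_Mapping.single a c" f'] by (auto split: if_splits)
  then have "lookup (Poly_Mapping.single a c * f') (a + m) = 0"
    by (simp add: in_keys_iff)
  then show ?thesis
    by (subst f) (simp add: distrib_left mult_single lookup_add)
qed

lemma lookup_cst_mult [simp]: "lookup (cst c * f) m = c * lookup f m"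
  using lookup_single_mult[of 0 c f m] by simp

lemma keys_single_mult_subset:
  fixes f :: "('v, 'k::comm_ring_1) mpoly"
  shows "keys (Poly_Mapping.single a c * f) \<subseteq> (+) a ` keys f"
  using keys_mult[of "Poly_Mapping.single a c" f] by (auto split: if_splits)

lemma sum_singles_keys:
  fixes f :: "'a \<Rightarrow>\<^sub>0 'b::comm_monoid_add"
  shows "(\<Sum>m\<in>keys f. Poly_Mapping.single m (lookup f m)) = f"
  by (rule poly_mapping_eqI)
    (simp add: lookup_sum lookup_single when_def in_keys_iff)

section \<open>Subspaces and ideals spanned by monomials\<close>

definition is_subspace :: "('v, 'k::comm_ring_1) mpoly set \<Rightarrow> bool" where
  "is_subspace A \<longleftrightarrow> 0 \<in> A \<and> (\<forall>a\<in>A. \<forall>b\<in>A. a + b \<in> A) \<and> (\<forall>c. \<forall>a\<in>A. cst c * a \<in> A)"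

lemma is_subspaceD:
  assumes "is_subspace A"
  shows "0 \<in> A" "a \<in> A \<Longrightarrow> b \<in> A \<Longrightarrow> a + b \<in> A" "a \<in> A \<Longrightarrow> cst c * a \<in> A"
    "a \<in> A \<Longrightarrow> b \<in> A \<Longrightarrow> a - b \<in> A"
proof -
  show "0 \<in> A" and add: "\<And>a b. a \<in> A \<Longrightarrow> b \<in> A \<Longrightarrow> a + b \<in> A"
    and mult: "\<And>c a. a \<in> A \<Longrightarrow> cst c * a \<in> A"
    using assms by (auto simp: is_subspace_def)
  show "a - b \<in> A" if "a \<in> A" "b \<in> A" for a b
    using add[OF that(1) mult[OF that(2), of "-1"]] by (simp add: single_uminus)
qed

lemma is_subspace_sum: "is_subspace A \<Longrightarrow> (\<And>x. x \<in> X \<Longrightarrow> f x \<in> A) \<Longrightarrow> sum f X \<in> A"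
  by (induction X rule: infinite_finite_induct) (auto simp: is_subspace_def)

lemma is_subspace_ideal: "is_ideal A \<Longrightarrow> is_subspace A"
  by (auto simp: is_ideal_def is_subspace_def)

lemma is_subspace_monomials:
  assumes "is_subspace A" "\<And>m. m \<in> keys f \<Longrightarrow> mon m \<in> A"
  shows "f \<in> A"
proof -
  have "cst (lookup f m) * mon m \<in> A" if "m \<in> keys f" for m
    using assms(2)[OF that] by (rule is_subspaceD(3)[OF assms(1)])
  then have "(\<Sum>m\<in>keys f. Poly_Mapping.single m (lookup f m)) \<in> A"
    by (intro is_subspace_sum assms(1)) (simp add: mult_single)
  then show ?thesis by (simp only: sum_singles_keys)
qed

text \<open>For a subspace this forces finite codimension, since the finitely many monomials outside
  \<open>A\<close> span the ring modulo \<open>A\<close>; unlike a dimension, it passes to larger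
  spaces by mere inclusion.\<close>

definition cofinite_monomials :: "('v, 'k::comm_ring_1) mpoly set \<Rightarrow> bool" where
  "cofinite_monomials A \<longleftrightarrow> finite {m. (mon m :: ('v, 'k) mpoly) \<notin> A}"

lemma cofinite_monomials_mono: "cofinite_monomials A \<Longrightarrow> A \<subseteq> B \<Longrightarrow> cofinite_monomials B"
  unfolding cofinite_monomials_def by (erule finite_subset[rotated]) auto

definition mon_span :: "('v \<Rightarrow>\<^sub>0 nat) set \<Rightarrow> ('v, 'k::comm_ring_1) mpoly set" where
  "mon_span U = {f. keys f \<subseteq> U}"

definition upset :: "('v \<Rightarrow>\<^sub>0 nat) set \<Rightarrow> bool" where
  "upset U \<longleftrightarrow> (\<forall>a b. b \<in> U \<longrightarrow> a + b \<in> U)"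

lemma is_subspace_mon_span: "is_subspace (mon_span U :: ('v, 'k::comm_ring_1) mpoly set)"
proof -
  have "keys (cst c * f) \<subseteq> U" if "keys f \<subseteq> U" for c and f :: "('v, 'k) mpoly"
    using keys_single_mult_subset[of 0 c f] that by auto
  moreover have "keys (f + g) \<subseteq> U" if "keys f \<subseteq> U" "keys g \<subseteq> U" for f g :: "('v, 'k) mpoly"
    using keys_add[of f g] that by blast
  ultimately show ?thesis
    by (simp add: is_subspace_def mon_span_def)
qed

lemma mon_in_mon_span [simp]: "mon m \<in> (mon_span U :: ('v, 'k::comm_ring_1) mpoly set) \<longleftrightarrow> m \<in> U"
  by (simp add: mon_span_def)

lemma mon_span_mult:
  assumes "f \<in> mon_span U" "g \<in> mon_span V" "\<And>a b. a \<in> U \<Longrightarrow> b \<in> V \<Longrightarrow> a + b \<in> W"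
  shows "f * g \<in> mon_span W"
  using assms keys_mult[of f g] unfolding mon_span_def by blast

lemma is_ideal_mon_span: "upset U \<Longrightarrow> is_ideal (mon_span U :: ('v, 'k::comm_ring_1) mpoly set)"
proof -
  assume "upset U"
  then have "r * f \<in> mon_span U" if "f \<in> mon_span U" for r f :: "('v, 'k::comm_ring_1) mpoly"
    using that by (intro mon_span_mult[of r UNIV f U U]) (auto simp: upset_def mon_span_def)
  then show "is_ideal (mon_span U :: ('v, 'k) mpoly set)"
    using is_subspace_mon_span[of U] unfolding is_ideal_def is_subspace_def by blast
qed

lemma mon_span_mono: "U \<subseteq> V \<Longrightarrow> mon_span U \<subseteq> mon_span V"
  by (auto simp: mon_span_def)

lemma mon_span_eq_ideal_gen:
  assumes "upset U"
  shows "ideal_gen (mon ` U) = (mon_span U :: ('v, 'k::comm_ring_1) mpoly set)"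
proof
  show "ideal_gen (mon ` U) \<subseteq> (mon_span U :: ('v, 'k) mpoly set)"
    using assms by (intro ideal_gen_minimal is_ideal_mon_span) auto
  show "mon_span U \<subseteq> (ideal_gen (mon ` U) :: ('v, 'k) mpoly set)"
  proof
    fix f :: "('v, 'k) mpoly" assume "f \<in> mon_span U"
    moreover have "(mon m :: ('v, 'k) mpoly) \<in> ideal_gen (mon ` U)" if "m \<in> U" for m
      by (rule subsetD[OF ideal_gen_superset]) (simp add: that)
    ultimately show "f \<in> ideal_gen (mon ` U)"
      by - (rule is_subspace_monomials[OF is_subspace_ideal[OF is_ideal_ideal_gen]], auto simp: mon_span_def)
  qed
qed

fun monom_pow :: "('v \<Rightarrow>\<^sub>0 nat) set \<Rightarrow> nat \<Rightarrow> ('v \<Rightarrow>\<^sub>0 nat) set" where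
  "monom_pow U 0 = UNIV"
| "monom_pow U (Suc n) = {a + b | a b. a \<in> U \<and> b \<in> monom_pow U n}"

lemma upset_monom_pow: "upset (monom_pow U n)"
proof (induction n)
  case (Suc n)
  show ?case unfolding upset_def
  proof (intro allI impI)
    fix c x assume "x \<in> monom_pow U (Suc n)"
    then obtain a b where x: "x = a + b" "a \<in> U" "b \<in> monom_pow U n" by auto
    moreover have "c + b \<in> monom_pow U n" using Suc x by (auto simp: upset_def)
    moreover have "c + x = a + (c + b)" by (simp add: x ac_simps)
    ultimately show "c + x \<in> monom_pow U (Suc n)" by auto
  qed
qed (simp add: upset_def)

lemma ideal_pow_mon_span:
  assumes "upset U"
  shows "ideal_pow (mon_span U) n = (mon_span (monom_pow U n) :: ('v, 'k::comm_ring_1) mpoly set)"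
proof (induction n)
  case 0
  then show ?case by (simp add: mon_span_def)
next
  case (Suc n)
  let ?P = "{a * b |a b. a \<in> (mon_span U :: ('v, 'k) mpoly set) \<and> b \<in> mon_span (monom_pow U n)}"
  have "mon ` monom_pow U (Suc n) \<subseteq> ?P"
  proof (intro image_subsetI)
    fix m assume "m \<in> monom_pow U (Suc n)"
    then obtain a b where "m = a + b" "a \<in> U" "b \<in> monom_pow U n" by auto
    then have "(mon m :: ('v, 'k) mpoly) = mon a * mon b"
      "mon a \<in> (mon_span U :: ('v, 'k) mpoly set)"
      "mon b \<in> (mon_span (monom_pow U n) :: ('v, 'k) mpoly set)" by (auto simp: mult_single)
    then show "(mon m :: ('v, 'k) mpoly) \<in> ?P" by blast
  qed
  then have "ideal_gen (mon ` monom_pow U (Suc n)) \<subseteq> ideal_gen ?P"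
    by (intro ideal_gen_minimal is_ideal_ideal_gen) (erule subset_trans[OF _ ideal_gen_superset])
  moreover have "ideal_gen ?P \<subseteq> mon_span (monom_pow U (Suc n))"
    by (intro ideal_gen_minimal is_ideal_mon_span upset_monom_pow) (auto intro: mon_span_mult)
  ultimately show ?case
    using mon_span_eq_ideal_gen[OF upset_monom_pow[of U "Suc n"], where ?'k='k] Suc by simp
qed

section \<open>Leading monomials compute lengths\<close>

definition mdeg :: "('v::finite \<Rightarrow>\<^sub>0 nat) \<Rightarrow> nat" where
  "mdeg m = (\<Sum>v\<in>UNIV. lookup m v)"

lemma mdeg_add: "mdeg (a + b) = mdeg a + mdeg b"
  by (simp add: mdeg_def lookup_add sum.distrib)

lemma mdeg_pos: "m \<noteq> 0 \<Longrightarrow> 0 < mdeg m"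
  by (rule ccontr) (auto simp: mdeg_def poly_mapping_eq_iff fun_eq_iff)

text \<open>The multiple found is a nonzero socle element of the quotient by \<open>A\<close>. If
  \<open>mon m * b\<close> is not in \<open>A\<close>, one of its monomials lies outside
  \<open>A\<close> and is divisible by \<open>mon m\<close>, so \<open>mdeg m\<close> is bounded; an
  \<open>m\<close> of largest degree works.\<close>

lemma ex_socle_multiple:
  fixes A :: "('v::finite, 'k::comm_ring_1) mpoly set"
  assumes A: "is_ideal A" "cofinite_monomials A" and b: "b \<notin> A"
  obtains m where "mon m * b \<notin> A" "\<And>m'. m' \<noteq> 0 \<Longrightarrow> mon m' * (mon m * b) \<in> A"
proof -
  let ?E = "{m. (mon m :: ('v, 'k) mpoly) \<notin> A}"
  have fin: "finite ?E" using A by (simp add: cofinite_monomials_def)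
  have bd: "mdeg m \<le> Max (mdeg ` ?E)" if m: "mon m * b \<notin> A" for m
  proof -
    obtain k where k: "k \<in> keys (mon m * b)" "k \<in> ?E"
      using is_subspace_monomials[OF is_subspace_ideal[OF A(1)]] m by blast
    then obtain k' where "k = m + k'"
      using keys_single_mult_subset[of m "1::'k" b] by auto
    then have "mdeg m \<le> mdeg k" by (simp add: mdeg_add)
    also have "mdeg k \<le> Max (mdeg ` ?E)" using k fin by simp
    finally show ?thesis .
  qed
  have "\<exists>m. mon m * b \<notin> A \<and> (\<forall>y. mon y * b \<notin> A \<longrightarrow> mdeg y \<le> mdeg m)"
    by (rule ex_has_greatest_nat[of _ 0 _ "Suc (Max (mdeg ` ?E))"])
      (use b bd in \<open>simp_all add: less_Suc_eq_le\<close>)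
  then obtain m where m: "mon m * b \<notin> A" and max: "\<And>y. mon y * b \<notin> A \<Longrightarrow> mdeg y \<le> mdeg m"
    by blast
  have "mon m' * (mon m * b) \<in> A" if "m' \<noteq> 0" for m'
  proof (rule ccontr)
    assume "mon m' * (mon m * b) \<notin> A"
    then have "mon (m' + m) * b \<notin> A" by (simp add: mult_single flip: mult.assoc)
    from max[OF this] mdeg_pos[OF that] show False by (simp add: mdeg_add)
  qed
  with m that show ?thesis by blast
qed

section \<open>Adjoining elements to a subspace\<close>

definition adjoin :: "('v, 'k::comm_ring_1) mpoly set \<Rightarrow> ('v, 'k) mpoly \<Rightarrow> ('v, 'k) mpoly set" where
  "adjoin A b = {a + cst c * b | a c. a \<in> A}"

lemma adjoinI: "a \<in> A \<Longrightarrow> x = a + cst c * b \<Longrightarrow> x \<in> adjoin A b"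
  by (auto simp: adjoin_def)

lemma subset_adjoin: "A \<subseteq> adjoin A b"
  by (auto intro: adjoinI[where c = 0])

lemma self_in_adjoin: "is_subspace A \<Longrightarrow> b \<in> adjoin A b"
  by (rule adjoinI[where a = 0 and c = 1]) (auto simp: is_subspaceD)

lemma is_subspace_adjoin:
  assumes A: "is_subspace A" shows "is_subspace (adjoin A b)"
  unfolding is_subspace_def
proof (intro conjI ballI allI)
  show "0 \<in> adjoin A b" using is_subspaceD(1)[OF A] subset_adjoin by blast
next
  fix x y assume "x \<in> adjoin A b" "y \<in> adjoin A b"
  then obtain a c a' c' where *: "a \<in> A" "x = a + cst c * b" "a' \<in> A" "y = a' + cst c' * b"
    unfolding adjoin_def by blast
  show "x + y \<in> adjoin A b"
    by (rule adjoinI[OF is_subspaceD(2)[OF A *(1,3)], of _ "c + c'"])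
      (simp add: * single_add algebra_simps)
next
  fix d x assume "x \<in> adjoin A b"
  then obtain a c where *: "a \<in> A" "x = a + cst c * b" unfolding adjoin_def by blast
  show "cst d * x \<in> adjoin A b"
    by (rule adjoinI[OF is_subspaceD(3)[OF A *(1), of d], of _ "d * c"])
      (simp add: * distrib_left mult_single flip: mult.assoc)
qed

lemma adjoin_subset: "is_subspace B \<Longrightarrow> A \<subseteq> B \<Longrightarrow> b \<in> B \<Longrightarrow> adjoin A b \<subseteq> B"
  by (auto simp: adjoin_def intro!: is_subspaceD)

lemma adjoin_eq_self: "is_subspace A \<Longrightarrow> b \<in> A \<Longrightarrow> adjoin A b = A"
  using adjoin_subset[of A A b] subset_adjoin by blast

text \<open>Polynomials without constant term multiply \<open>b\<close> into \<open>A\<close>, so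
  modulo \<open>A\<close> a multiple of \<open>b\<close> depends only on the constant term of the
  factor.\<close>

lemma is_ideal_adjoin:
  assumes A: "is_ideal A" and b: "\<And>m. m \<noteq> 0 \<Longrightarrow> mon m * b \<in> A"
  shows "is_ideal (adjoin A b)"
proof -
  note S = is_subspace_adjoin[OF is_subspace_ideal[OF A], of b]
  have "r * b \<in> adjoin A b" for r
  proof -
    define q where "q = r - cst (lookup r 0)"
    have "is_subspace {a. \<forall>x\<in>{b}. a * x \<in> A}"
      by (intro is_subspace_ideal is_ideal_colon A)
    then have "q \<in> {a. \<forall>x\<in>{b}. a * x \<in> A}"
    proof (rule is_subspace_monomials)
      fix m assume "m \<in> keys q"
      then have "m \<noteq> 0" by (auto simp: q_def in_keys_iff lookup_minus)
      then show "mon m \<in> {a. \<forall>x\<in>{b}. a * x \<in> A}" using b by simp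
    qed
    then have "q * b \<in> A" by simp
    then show ?thesis
      by (rule adjoinI[where c = "lookup r 0"]) (simp add: q_def algebra_simps)
  qed
  note rb = this
  have "r * x \<in> adjoin A b" if "x \<in> adjoin A b" for r x
  proof -
    from that obtain a c where *: "a \<in> A" "x = a + cst c * b" unfolding adjoin_def by blast
    have "r * a \<in> adjoin A b" using is_idealD(3)[OF A *(1)] subset_adjoin by blast
    moreover have "cst c * (r * b) \<in> adjoin A b" by (rule is_subspaceD(3)[OF S rb])
    ultimately have "r * a + cst c * (r * b) \<in> adjoin A b" by (rule is_subspaceD(2)[OF S])
    then show ?thesis by (simp add: * algebra_simps)
  qed
  then show ?thesis using S unfolding is_ideal_def is_subspace_def by blast
qed

text \<open>The span is that of an indexed family rather than of a set, because the indices are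
  later ordered and counted, even where two of them carry the same polynomial.\<close>

definition span_over :: "('v, 'k::comm_ring_1) mpoly set \<Rightarrow> ('t \<Rightarrow> ('v, 'k) mpoly) \<Rightarrow> 't set \<Rightarrow> ('v, 'k) mpoly set" where
  "span_over A e S = {a + (\<Sum>t\<in>S. cst (c t) * e t) | a c. a \<in> A}"

lemma span_overI: "a \<in> A \<Longrightarrow> x = a + (\<Sum>t\<in>S. cst (c t) * e t) \<Longrightarrow> x \<in> span_over A e S"
  by (auto simp: span_over_def)

lemma span_over_empty [simp]: "span_over A e {} = A"
  by (auto simp: span_over_def)

lemma span_over_insert:
  assumes "finite S" "t \<notin> S"
  shows "span_over A e (insert t S) = adjoin (span_over A e S) (e t)"
proof (intro equalityI subsetI)
  fix x assume "x \<in> span_over A e (insert t S)"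
  then obtain a c where *: "a \<in> A" "x = a + (\<Sum>t\<in>insert t S. cst (c t) * e t)" unfolding span_over_def by blast
  show "x \<in> adjoin (span_over A e S) (e t)"
    by (rule adjoinI[OF span_overI[OF *(1) refl], of _ c _ _ "c t"]) (use assms * in \<open>simp add: ac_simps\<close>)
next
  fix x assume "x \<in> adjoin (span_over A e S) (e t)"
  then obtain a c d where *: "a \<in> A" "x = a + (\<Sum>t\<in>S. cst (c t) * e t) + cst d * e t"
    unfolding span_over_def adjoin_def by blast
  have "(\<Sum>s\<in>S. cst ((c(t := d)) s) * e s) = (\<Sum>t\<in>S. cst (c t) * e t)"
    by (rule sum.cong) (use assms in auto)
  then have "x = a + (\<Sum>s\<in>insert t S. cst ((c(t := d)) s) * e s)"
    using assms * by (simp add: ac_simps)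
  then show "x \<in> span_over A e (insert t S)" by (rule span_overI[OF *(1)])
qed

lemma span_over_adjoin_commute: "span_over (adjoin A b) e S = adjoin (span_over A e S) b"
proof (intro equalityI subsetI)
  fix x assume "x \<in> span_over (adjoin A b) e S"
  then obtain a c d where *: "a \<in> A" "x = a + cst d * b + (\<Sum>t\<in>S. cst (c t) * e t)"
    unfolding span_over_def adjoin_def by blast
  show "x \<in> adjoin (span_over A e S) b"
    by (rule adjoinI[OF span_overI[OF *(1) refl], of _ c _ _ d]) (simp add: * ac_simps)
next
  fix x assume "x \<in> adjoin (span_over A e S) b"
  then obtain a c d where *: "a \<in> A" "x = a + (\<Sum>t\<in>S. cst (c t) * e t) + cst d * b"
    unfolding span_over_def adjoin_def by blast
  show "x \<in> span_over (adjoin A b) e S"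
    by (rule span_overI[OF adjoinI[OF *(1) refl], of _ d _ c]) (simp add: * ac_simps)
qed

lemma is_subspace_span_over: "finite S \<Longrightarrow> is_subspace A \<Longrightarrow> is_subspace (span_over A e S)"
  by (induction S rule: finite_induct) (simp_all add: span_over_insert is_subspace_adjoin)

lemma subset_span_over: "A \<subseteq> span_over A e S"
  by (auto intro: span_overI[where c = "\<lambda>_. 0"])

lemma span_over_subset:
  assumes "is_subspace B" "A \<subseteq> B" "\<And>t. t \<in> S \<Longrightarrow> e t \<in> B"
  shows "span_over A e S \<subseteq> B"
proof
  fix x assume "x \<in> span_over A e S"
  then obtain a c where *: "a \<in> A" "x = a + (\<Sum>t\<in>S. cst (c t) * e t)" unfolding span_over_def by blast
  have "(\<Sum>t\<in>S. cst (c t) * e t) \<in> B"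
    by (intro is_subspace_sum is_subspaceD(3) assms)
  then show "x \<in> B" using * assms by (auto intro: is_subspaceD(2))
qed

lemma in_span_over:
  assumes "finite S" "is_subspace A" "t \<in> S"
  shows "e t \<in> span_over A e S"
proof -
  have "span_over A e S = adjoin (span_over A e (S - {t})) (e t)"
    using span_over_insert[of "S - {t}" t A e] assms by (simp add: insert_absorb)
  then show ?thesis using assms by (simp add: self_in_adjoin is_subspace_span_over)
qed

text \<open>Discarding the monomials that lie in \<open>A\<close> changes \<open>g\<close> only
  modulo \<open>A\<close> and leaves its exponents in a fixed finite set.\<close>

lemma cofinite_monomials_truncate:
  fixes A :: "('v, 'k::comm_ring_1) mpoly set"
  assumes A: "is_subspace A" "cofinite_monomials A"
  obtains g0 where "g - g0 \<in> A" "\<And>m. lookup g0 m = (if mon m \<in> A then 0 else lookup g m)"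
proof -
  let ?E = "{m. (mon m :: ('v, 'k) mpoly) \<notin> A}"
  define g0 where "g0 = (\<Sum>m\<in>keys g \<inter> ?E. Poly_Mapping.single m (lookup g m))"
  have g0: "lookup g0 m = (if mon m \<in> A then 0 else lookup g m)" for m
    by (simp add: g0_def lookup_sum lookup_single when_def in_keys_iff)
  have "g - g0 \<in> A"
  proof (rule is_subspace_monomials[OF A(1)])
    fix m assume "m \<in> keys (g - g0)"
    then show "mon m \<in> A" by (auto simp: in_keys_iff lookup_minus g0 split: if_splits)
  qed
  with g0 that show ?thesis by blast
qed

section \<open>Leading monomials and codimension\<close>

locale monomial_order =
  fixes le :: "('v::finite \<Rightarrow>\<^sub>0 nat) \<Rightarrow> ('v \<Rightarrow>\<^sub>0 nat) \<Rightarrow> bool"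
  assumes term_order: "term_order le"
begin

lemma le_refl [simp]: "le a a"
  and le_antisym: "le a b \<Longrightarrow> le b a \<Longrightarrow> a = b"
  and le_trans: "le a b \<Longrightarrow> le b c \<Longrightarrow> le a c"
  and le_linear: "le a b \<or> le b a"
  and le_add_right: "le a b \<Longrightarrow> le (a + c) (b + c)"
  and le_add_left: "le a b \<Longrightarrow> le (c + a) (c + b)"
  using term_order unfolding term_order_def by (blast, blast, blast, blast, blast, metis add.commute)

lemma ex_max: "finite S \<Longrightarrow> S \<noteq> {} \<Longrightarrow> \<exists>m\<in>S. \<forall>x\<in>S. le x m"
proof (induction S rule: finite_ne_induct)
  case (insert x F)
  then obtain m where m: "m \<in> F" "\<forall>x\<in>F. le x m" by blast
  then show ?case using le_linear[of x m] by (metis insert_iff le_refl le_trans)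
qed auto

lemma lead_monom_eqI: "m \<in> keys f \<Longrightarrow> (\<And>m'. m' \<in> keys f \<Longrightarrow> le m' m) \<Longrightarrow> lead_monom le f = m"
  unfolding lead_monom_def by (rule the_equality) (auto intro: le_antisym)

lemma lead_monom:
  assumes "f \<noteq> 0"
  shows "lead_monom le f \<in> keys f" "m \<in> keys f \<Longrightarrow> le m (lead_monom le f)"
proof -
  have "keys f \<noteq> {}"
    using assms by (metis poly_mapping_eqI lookup_zero ex_in_conv in_keys_iff)
  then obtain u where "u \<in> keys f" "\<forall>x\<in>keys f. le x u" using ex_max[of "keys f"] by auto
  with lead_monom_eqI[of u f]
  show "lead_monom le f \<in> keys f" "m \<in> keys f \<Longrightarrow> le m (lead_monom le f)" by auto
qed

lemma lead_monom_mon [simp]: "lead_monom le (mon m :: ('v, 'k::comm_ring_1) mpoly) = m"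
  by (rule lead_monom_eqI) auto

text \<open>Compatibility of the order with addition shows that the sum of the two leading exponents
  arises from no other pair of exponents, so its coefficient is a product of two nonzero elements of
  a domain.\<close>

lemma mult_ne_0_lead_monom:
  fixes f g :: "('v, 'k::idom) mpoly"
  assumes "f \<noteq> 0" "g \<noteq> 0"
  shows "f * g \<noteq> 0" "lead_monom le (f * g) = lead_monom le f + lead_monom le g"
proof -
  let ?a = "lead_monom le f" and ?b = "lead_monom le g"
  define f' where "f' = f - Poly_Mapping.single ?a (lookup f ?a)"
  have keys_f': "keys f' \<subseteq> keys f - {?a}"
    by (auto simp: f'_def in_keys_iff lookup_minus lookup_single when_def split: if_splits)
  have "?a + ?b \<notin> keys (f' * g)"
  proof
    assume "?a + ?b \<in> keys (f' * g)"
    then obtain x y where xy: "x \<in> keys f'" "y \<in> keys g" "?a + ?b = x + y"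
      using keys_mult[of f' g] by blast
    have "le x ?a" "le y ?b"
      using xy keys_f' lead_monom(2) assms by auto
    then have "le (x + y) (x + ?b)" "le (x + ?b) (?a + ?b)"
      by (auto intro: le_add_left le_add_right)
    then have "x + ?b = ?a + ?b" using xy(3) le_antisym by metis
    then show False using xy keys_f' by auto
  qed
  moreover have "f * g = Poly_Mapping.single ?a (lookup f ?a) * g + f' * g"
    by (simp add: f'_def algebra_simps)
  ultimately have "lookup (f * g) (?a + ?b) = lookup f ?a * lookup g ?b"
    by (simp add: lookup_add lookup_single_mult in_keys_iff)
  moreover have "lookup f ?a \<noteq> 0" "lookup g ?b \<noteq> 0"
    using lead_monom(1)[OF assms(1)] lead_monom(1)[OF assms(2)] by (auto simp: in_keys_iff)
  ultimately have key: "?a + ?b \<in> keys (f * g)"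
    by (simp add: in_keys_iff)
  then show "f * g \<noteq> 0" by auto
  show "lead_monom le (f * g) = ?a + ?b"
  proof (rule lead_monom_eqI[OF key])
    fix m assume "m \<in> keys (f * g)"
    then obtain x y where xy: "x \<in> keys f" "y \<in> keys g" "m = x + y"
      using keys_mult[of f g] by blast
    then have "le x ?a" "le y ?b"
      using lead_monom(2) assms by auto
    then show "le m (?a + ?b)"
      using xy(3) le_add_left le_add_right le_trans by metis
  qed
qed

definition lead_monoms :: "('v, 'k::comm_ring_1) mpoly set \<Rightarrow> ('v \<Rightarrow>\<^sub>0 nat) set" where
  "lead_monoms A = {lead_monom le f | f. f \<in> A \<and> f \<noteq> 0}"

lemma lead_monomsI: "f \<in> A \<Longrightarrow> f \<noteq> 0 \<Longrightarrow> lead_monom le f \<in> lead_monoms A"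
  by (auto simp: lead_monoms_def)

lemma lead_monoms_mono: "A \<subseteq> B \<Longrightarrow> lead_monoms A \<subseteq> lead_monoms B"
  by (auto simp: lead_monoms_def)

lemma mon_in_lead_monoms: "(mon m :: ('v, 'k::comm_ring_1) mpoly) \<in> A \<Longrightarrow> m \<in> lead_monoms A"
  using lead_monomsI[of "mon m" A] by (metis lead_monom_mon lookup_single_eq lookup_zero zero_neq_one)

lemma lead_monoms_mon_span [simp]: "lead_monoms (mon_span U :: ('v, 'k::comm_ring_1) mpoly set) = U"
proof
  show "lead_monoms (mon_span U :: ('v, 'k) mpoly set) \<subseteq> U"
    using lead_monom(1) by (fastforce simp: lead_monoms_def mon_span_def)
  show "U \<subseteq> lead_monoms (mon_span U :: ('v, 'k) mpoly set)"
    by (auto intro: mon_in_lead_monoms)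
qed

lemma lead_monoms_add:
  fixes A B C :: "('v, 'k::idom) mpoly set"
  assumes "\<And>f g. f \<in> A \<Longrightarrow> g \<in> B \<Longrightarrow> f * g \<in> C" "a \<in> lead_monoms A" "b \<in> lead_monoms B"
  shows "a + b \<in> lead_monoms C"
proof -
  obtain f g where "f \<in> A" "f \<noteq> 0" "a = lead_monom le f" "g \<in> B" "g \<noteq> 0" "b = lead_monom le g"
    using assms(2,3) by (auto simp: lead_monoms_def)
  with assms(1) mult_ne_0_lead_monom[of f g] lead_monomsI[of "f * g" C] show ?thesis by metis
qed

lemma upset_lead_monoms: "is_ideal I \<Longrightarrow> upset (lead_monoms (I :: ('v, 'k::idom) mpoly set))"
  unfolding upset_def using lead_monoms_add[of UNIV I I] is_idealD(3)[of I] mon_in_lead_monoms[of _ "UNIV :: ('v, 'k) mpoly set"]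
  by blast

lemma finite_compl_lead_monoms:
  assumes "cofinite_monomials (A :: ('v, 'k::comm_ring_1) mpoly set)" shows "finite (- lead_monoms A)"
  by (rule finite_subset[OF _ assms[unfolded cofinite_monomials_def]]) (auto dest: mon_in_lead_monoms)

text \<open>Gaussian elimination: subtracting scalar multiples of elements of \<open>A\<close> with
  the same leading monomial reduces every element of \<open>B\<close> to zero.\<close>

lemma subset_of_lead_monoms_subset:
  fixes A B :: "('v, 'k::field) mpoly set"
  assumes A: "is_subspace A" "cofinite_monomials A" and B: "is_subspace B" and AB: "A \<subseteq> B" and sub: "lead_monoms B \<subseteq> lead_monoms A"
  shows "B \<subseteq> A"
proof -
  let ?E = "{m. (mon m :: ('v, 'k) mpoly) \<notin> A}"
  \<comment> \<open>For nonzero \<open>g\<close> supported outside \<open>A\<close>, these are the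
    monomials outside \<open>A\<close> up to the leading one of \<open>g\<close>. Their number drops
    whenever the leading term is cancelled, which serves as the termination measure.\<close>
  let ?D = "\<lambda>g :: ('v, 'k) mpoly. {m \<in> ?E. \<exists>k\<in>keys g. le m k}"
  have fin: "finite ?E" using A by (simp add: cofinite_monomials_def)
  have *: "g \<in> A" if "g \<in> B" "keys g \<subseteq> ?E" for g
    using that
  proof (induction "card (?D g)" arbitrary: g rule: less_induct)
    case less
    show ?case
    proof (cases "g = 0")
      case True
      then show ?thesis using A by (simp add: is_subspaceD)
    next
      case False
      let ?u = "lead_monom le g"
      have u: "?u \<in> keys g" "\<And>m. m \<in> keys g \<Longrightarrow> le m ?u" using lead_monom[OF False] by auto
      have "?u \<in> lead_monoms A" using sub lead_monomsI[OF less.prems(1) False] by blast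
      then obtain a where a: "a \<in> A" "a \<noteq> 0" "lead_monom le a = ?u" by (auto simp: lead_monoms_def)
      obtain a0 where a0: "a - a0 \<in> A" "\<And>m. lookup a0 m = (if mon m \<in> A then 0 else lookup a m)"
        using cofinite_monomials_truncate[OF A] by metis
      have "a0 \<in> A" using is_subspaceD(4)[OF A(1) a(1) a0(1)] by simp
      have keys_a0: "keys a0 \<subseteq> ?E" "\<And>m. m \<in> keys a0 \<Longrightarrow> le m ?u"
        using a0(2) lead_monom(2)[OF a(2)] a(3) by (auto simp: in_keys_iff split: if_splits)
      \<comment> \<open>The leading term of \<open>a\<close> survives truncation, because its
        monomial also occurs in \<open>g\<close> and therefore lies outside
        \<open>A\<close>.\<close>
      have ne: "lookup a0 ?u \<noteq> 0"
        using lead_monom(1)[OF a(2)] a0(2)[of ?u] u(1) less.prems(2) a(3) by (auto simp: in_keys_iff)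
      define c where "c = lookup g ?u / lookup a0 ?u"
      define g' where "g' = g - cst c * a0"
      have keys_g': "keys g' \<subseteq> keys g \<union> keys a0"
        by (auto simp: g'_def in_keys_iff lookup_minus)
      have nu: "?u \<notin> keys g'"
        using ne by (simp add: g'_def c_def in_keys_iff lookup_minus)
      have "cst c * a0 \<in> A" using is_subspaceD(3)[OF A(1) \<open>a0 \<in> A\<close>] .
      then have "g' \<in> B" unfolding g'_def using AB less.prems(1) B by (auto intro: is_subspaceD(4))
      moreover have "keys g' \<subseteq> ?E" using keys_g' keys_a0 less.prems(2) by blast
      moreover have "card (?D g') < card (?D g)"
      proof (rule psubset_card_mono)
        show "finite (?D g)" using fin by simp
        have le_u: "le k ?u" "k \<noteq> ?u" if "k \<in> keys g'" for k
          using that keys_g' keys_a0(2) u(2) nu by blast+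
        have "?D g' \<subseteq> ?D g" using le_u u(1) le_trans by blast
        moreover have "?u \<in> ?D g" using u(1) less.prems(2) le_refl by blast
        moreover have "?u \<notin> ?D g'" using le_u le_antisym by blast
        ultimately show "?D g' \<subset> ?D g" by blast
      qed
      ultimately have "g' \<in> A" using less.hyps by blast
      then have "g' + cst c * a0 \<in> A" using \<open>cst c * a0 \<in> A\<close> by (rule is_subspaceD(2)[OF A(1)])
      then show ?thesis by (simp add: g'_def)
    qed
  qed
  show ?thesis
  proof
    fix g assume g: "g \<in> B"
    obtain g0 where g0: "g - g0 \<in> A" "\<And>m. lookup g0 m = (if mon m \<in> A then 0 else lookup g m)"
      using cofinite_monomials_truncate[OF A] by metis
    have "g - (g - g0) \<in> B" by (rule is_subspaceD(4)[OF B g]) (use g0(1) AB in blast)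
    then have "g0 \<in> B" by simp
    moreover have "keys g0 \<subseteq> ?E" by (auto simp: in_keys_iff g0(2) split: if_splits)
    ultimately have "g0 \<in> A" by (rule *)
    from is_subspaceD(2)[OF A(1) g0(1) this] show "g \<in> A" by simp
  qed
qed

text \<open>If there were two new leading monomials, eliminating \<open>b\<close> between the
  corresponding polynomials would produce an element of \<open>A\<close> whose leading exponent is
  the larger of them. If there were none, \<open>b\<close> would already lie in
  \<open>A\<close>.\<close>

lemma lead_monoms_adjoin:
  fixes A :: "('v, 'k::field) mpoly set"
  assumes A: "is_subspace A" "cofinite_monomials A" and b: "b \<notin> A"
  obtains u where "u \<notin> lead_monoms A" "lead_monoms (adjoin A b) = insert u (lead_monoms A)"
proof -
  have aux: "u \<in> lead_monoms A"
    if f: "f \<in> adjoin A b" "f \<noteq> 0" "lead_monom le f = u"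
      and g: "g \<in> adjoin A b" "g \<noteq> 0" "lead_monom le g = v"
      and uv: "v \<notin> lead_monoms A" "le v u" "u \<noteq> v" for f g u v
  proof -
    obtain a c where ac: "a \<in> A" "f = a + cst c * b" using f(1) unfolding adjoin_def by blast
    obtain a' c' where ac': "a' \<in> A" "g = a' + cst c' * b" using g(1) unfolding adjoin_def by blast
    \<comment> \<open>Otherwise \<open>g\<close> would lie in \<open>A\<close> and \<open>v\<close>
      would not be new.\<close>
    have "c' \<noteq> 0" using ac' g uv(1) lead_monomsI[of g A] by auto
    define h where "h = cst c' * f - cst c * g"
    have "h = cst c' * a - cst c * a'"
      by (simp add: h_def ac ac' algebra_simps mult_single flip: mult.assoc)
    then have "h \<in> A" using A ac ac' by (auto intro!: is_subspaceD)
    have "u \<notin> keys g" using lead_monom(2)[OF g(2)] g(3) uv le_antisym by blast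
    then have key: "u \<in> keys h" 
      using lead_monom(1)[OF f(2)] f(3) \<open>c' \<noteq> 0\<close> by (simp add: h_def in_keys_iff lookup_minus)
    have "lead_monom le h = u"
    proof (rule lead_monom_eqI[OF key])
      fix m assume "m \<in> keys h"
      then have "m \<in> keys f \<or> m \<in> keys g" by (auto simp: h_def in_keys_iff lookup_minus)
      then show "le m u" using lead_monom(2)[OF f(2)] lead_monom(2)[OF g(2)] f(3) g(3) uv(2) le_trans by blast
    qed
    then show ?thesis using lead_monomsI[OF \<open>h \<in> A\<close>] key by force
  qed
  have "\<not> lead_monoms (adjoin A b) \<subseteq> lead_monoms A"
    using subset_of_lead_monoms_subset[OF A is_subspace_adjoin[OF A(1)] subset_adjoin] self_in_adjoin[OF A(1)] b by blast
  then obtain u where u: "u \<in> lead_monoms (adjoin A b)" "u \<notin> lead_monoms A" by blast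
  have "v = u" if v: "v \<in> lead_monoms (adjoin A b)" "v \<notin> lead_monoms A" for v
  proof (rule ccontr)
    assume ne: "v \<noteq> u"
    obtain f where f: "f \<in> adjoin A b" "f \<noteq> 0" "lead_monom le f = u" using u by (auto simp: lead_monoms_def)
    obtain g where g: "g \<in> adjoin A b" "g \<noteq> 0" "lead_monom le g = v" using v by (auto simp: lead_monoms_def)
    from le_linear[of u v] aux[OF f g] aux[OF g f] ne u v show False by auto
  qed
  then have "lead_monoms (adjoin A b) = insert u (lead_monoms A)" using u lead_monoms_mono[OF subset_adjoin[of A b]] by blast
  with u that show ?thesis by blast
qed

lemma card_lead_monoms_adjoin:
  fixes A :: "('v, 'k::field) mpoly set"
  assumes A: "is_subspace A" "cofinite_monomials A" and B: "is_subspace B" "A \<subseteq> B" and b: "b \<notin> B"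
  shows "card (lead_monoms (adjoin B b) - lead_monoms A) = Suc (card (lead_monoms B - lead_monoms A))"
proof -
  have cB: "cofinite_monomials B" using A B cofinite_monomials_mono by blast
  obtain u where u: "u \<notin> lead_monoms B" "lead_monoms (adjoin B b) = insert u (lead_monoms B)"
    using lead_monoms_adjoin[OF B(1) cB b] by blast
  have "finite (lead_monoms B - lead_monoms A)"
    by (rule finite_subset[OF _ finite_compl_lead_monoms[OF A(2)]]) auto
  moreover have "lead_monoms (adjoin B b) - lead_monoms A = insert u (lead_monoms B - lead_monoms A)"
    using u lead_monoms_mono[OF B(2)] by auto
  ultimately show ?thesis using u by auto
qed

text \<open>Greedy choice of a basis modulo \<open>A\<close>: with the indices taken in increasing
  order, \<open>e t\<close> adds a dimension exactly when it is outside the span of its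
  predecessors.\<close>

lemma card_lead_monoms_span_over:
  fixes A :: "('v, 'k::field) mpoly set" and e :: "'t::linorder \<Rightarrow> ('v, 'k) mpoly"
  assumes S: "finite S" and A: "is_subspace A" "cofinite_monomials A"
  shows "card (lead_monoms (span_over A e S) - lead_monoms A) = card {t \<in> S. e t \<notin> span_over A e {t' \<in> S. t' < t}}"
  using S
proof (induction S rule: finite_linorder_max_induct)
  case (insert b S)
  let ?T = "{t \<in> S. e t \<notin> span_over A e {t' \<in> S. t' < t}}"
  have b: "b \<notin> S" using insert by auto
  have *: "{t' \<in> insert b S. t' < b} = S" "\<And>t. t \<in> S \<Longrightarrow> {t' \<in> insert b S. t' < t} = {t' \<in> S. t' < t}"
    using insert by auto
  have eq: "{t \<in> insert b S. e t \<notin> span_over A e {t' \<in> insert b S. t' < t}} =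
      (if e b \<in> span_over A e S then ?T else insert b ?T)"
    using * by auto
  have span_over: "span_over A e (insert b S) = adjoin (span_over A e S) (e b)"
    using b insert by (simp add: span_over_insert)
  show ?case
  proof (cases "e b \<in> span_over A e S")
    case True
    then show ?thesis using insert eq span_over adjoin_eq_self[OF is_subspace_span_over[OF \<open>finite S\<close> A(1)]] by simp
  next
    case False
    then show ?thesis
      using insert eq span_over b card_lead_monoms_adjoin[OF A is_subspace_span_over[OF \<open>finite S\<close> A(1)] subset_span_over False] by simp
  qed
qed simp

lemma card_lead_monoms_span_over_independent:
  fixes A :: "('v, 'k::field) mpoly set"
  assumes S: "finite S" and A: "is_subspace A" "cofinite_monomials A"
    and ind: "\<And>c t. (\<Sum>t\<in>S. cst (c t) * e t) \<in> A \<Longrightarrow> t \<in> S \<Longrightarrow> c t = 0"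
  shows "card (lead_monoms (span_over A e S) - lead_monoms A) = card S"
  using S ind
proof (induction S rule: finite_induct)
  case (insert b S)
  have nin: "e b \<notin> span_over A e S"
  proof
    assume "e b \<in> span_over A e S"
    then obtain a c where ac: "a \<in> A" "e b = a + (\<Sum>t\<in>S. cst (c t) * e t)" unfolding span_over_def by blast
    let ?c = "\<lambda>t. if t = b then 1 else - c t"
    have "(\<Sum>t\<in>S. cst (?c t) * e t) = (\<Sum>t\<in>S. - (cst (c t) * e t))"
      using insert(2) by (intro sum.cong) (auto simp: single_uminus)
    then have "(\<Sum>t\<in>insert b S. cst (?c t) * e t) = a"
      using insert(1,2) ac(2) by (simp add: sum_negf)
    then have "?c b = 0" using insert.prems[of ?c b] ac(1) by simp
    then show False by simp
  qed
  have "c t = 0" if c: "(\<Sum>t\<in>S. cst (c t) * e t) \<in> A" and t: "t \<in> S" for c t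
  proof -
    have "(\<Sum>t\<in>S. cst ((c(b := 0)) t) * e t) = (\<Sum>t\<in>S. cst (c t) * e t)"
      using insert(2) by (intro sum.cong) auto
    then have "(\<Sum>t\<in>insert b S. cst ((c(b := 0)) t) * e t) \<in> A"
      using insert(1,2) c by simp
    from insert.prems[OF this, of t] t insert(2) show ?thesis by (auto split: if_splits)
  qed
  then have "card (lead_monoms (span_over A e S) - lead_monoms A) = card S" by (rule insert.IH)
  then show ?case
    using insert(1,2) card_lead_monoms_adjoin[OF A is_subspace_span_over[OF insert(1) A(1)] subset_span_over nin] by (simp add: span_over_insert)
qed simp

lemma card_lead_monoms_psubset:
  fixes A :: "('v, 'k::field) mpoly set"
  assumes "is_subspace B" "cofinite_monomials A" "A \<subseteq> B" "is_subspace C" "B \<subset> C"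
  shows "card (lead_monoms B - lead_monoms A) < card (lead_monoms C - lead_monoms A)"
proof (rule psubset_card_mono)
  show "finite (lead_monoms C - lead_monoms A)"
    by (rule finite_subset[OF _ finite_compl_lead_monoms[OF assms(2)]]) auto
  have "\<not> lead_monoms C \<subseteq> lead_monoms B"
    using subset_of_lead_monoms_subset[of B C] assms cofinite_monomials_mono by blast
  moreover have "lead_monoms B \<subseteq> lead_monoms C" "lead_monoms A \<subseteq> lead_monoms B" using assms by (auto intro!: lead_monoms_mono)
  ultimately show "lead_monoms B - lead_monoms A \<subset> lead_monoms C - lead_monoms A" by blast
qed

text \<open>Each adjoined element uses up one of the finitely many leading monomials of
  \<open>B\<close> missing from \<open>A\<close>, so adjoining stops after finitely many
  steps.\<close>

lemma ex_finite_span_over: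
  fixes A :: "('v, 'k::field) mpoly set"
  assumes "is_subspace A" "cofinite_monomials A" "is_subspace B" "A \<subseteq> B"
  shows "\<exists>e (n::nat). (\<forall>j<n. e j \<in> B) \<and> B = span_over A e {..<n}"
  using assms
proof (induction "card (lead_monoms B - lead_monoms A)" arbitrary: A rule: less_induct)
  case less
  show ?case
  proof (cases "B \<subseteq> A")
    case True
    then show ?thesis using less.prems by (intro exI[of _ "\<lambda>_. 0"] exI[of _ 0]) auto
  next
    case False
    then obtain b where b: "b \<in> B" "b \<notin> A" by blast
    let ?A = "adjoin A b"
    have 1: "?A \<subseteq> B" "is_subspace ?A" "cofinite_monomials ?A"
      using adjoin_subset[OF less.prems(3,4) b(1)] is_subspace_adjoin[OF less.prems(1)]
        cofinite_monomials_mono[OF less.prems(2) subset_adjoin] by auto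
    obtain u where "u \<notin> lead_monoms A" "lead_monoms ?A = insert u (lead_monoms A)"
      using lead_monoms_adjoin[OF less.prems(1,2) b(2)] by metis
    then have "lead_monoms B - lead_monoms ?A \<subset> lead_monoms B - lead_monoms A"
      using lead_monoms_mono[OF 1(1)] by blast
    then have "card (lead_monoms B - lead_monoms ?A) < card (lead_monoms B - lead_monoms A)"
      by (intro psubset_card_mono finite_subset[OF _ finite_compl_lead_monoms[OF less.prems(2)]]) auto
    from less.hyps[OF this 1(2,3) less.prems(3) 1(1)] obtain e and n :: nat
      where e: "\<forall>j<n. e j \<in> B" "B = span_over ?A e {..<n}" by blast
    let ?e = "e(n := b)"
    have "span_over A ?e {..<n} = span_over A e {..<n}" by (auto simp: span_over_def)
    then have "span_over A ?e {..<Suc n} = B"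
      by (simp add: lessThan_Suc span_over_insert e(2) span_over_adjoin_commute)
    then show ?thesis using e(1) b(1) by (intro exI[of _ ?e] exI[of _ "Suc n"]) (auto simp: less_Suc_eq)
  qed
qed

text \<open>Adjoining a socle element of the quotient by \<open>A\<close> gives an ideal again and
  uses up exactly one missing leading monomial, so length and dimension stay in step.\<close>

lemma ex_ideal_chain:
  fixes A B :: "('v, 'k::field) mpoly set"
  assumes "is_ideal A" "is_ideal B" "cofinite_monomials A" "A \<subseteq> B"
  shows "\<exists>N :: nat \<Rightarrow> ('v, 'k) mpoly set. N 0 = A \<and> N (card (lead_monoms B - lead_monoms A)) = B \<and>
      (\<forall>i\<le>card (lead_monoms B - lead_monoms A). is_ideal (N i)) \<and> (\<forall>i<card (lead_monoms B - lead_monoms A). N i \<subset> N (Suc i))"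
  using assms
proof (induction "card (lead_monoms B - lead_monoms A)" arbitrary: A)
  case 0
  have "finite (lead_monoms B - lead_monoms A)"
    by (rule finite_subset[OF _ finite_compl_lead_monoms[OF \<open>cofinite_monomials A\<close>]]) auto
  then have "lead_monoms B \<subseteq> lead_monoms A" using 0(1) by simp
  then have "B \<subseteq> A"
    by (rule subset_of_lead_monoms_subset[OF is_subspace_ideal[OF 0(2)] 0(4) is_subspace_ideal[OF 0(3)] 0(5)])
  with 0 show ?case by (intro exI[of _ "\<lambda>_. A"]) auto
next
  case (Suc l)
  have "lead_monoms B - lead_monoms A \<noteq> {}"
    using Suc.hyps(2) by (metis Zero_not_Suc card.empty)
  then have "\<not> B \<subseteq> A" using lead_monoms_mono by blast
  then obtain b where b: "b \<in> B" "b \<notin> A" by blast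
  obtain m where m: "mon m * b \<notin> A" "\<And>m'. m' \<noteq> 0 \<Longrightarrow> mon m' * (mon m * b) \<in> A"
    using ex_socle_multiple[OF Suc.prems(1,3) b(2)] by metis
  let ?b = "mon m * b" and ?A = "adjoin A (mon m * b)"
  have sA: "is_subspace A" "is_subspace B" using Suc.prems by (auto intro: is_subspace_ideal)
  have 1: "is_ideal ?A" using is_ideal_adjoin[OF Suc.prems(1) m(2)] by blast
  have 2: "?A \<subseteq> B" by (intro adjoin_subset sA Suc.prems is_idealD b)
  have 3: "cofinite_monomials ?A" using cofinite_monomials_mono[OF Suc.prems(3) subset_adjoin] .
  obtain u where u: "u \<notin> lead_monoms A" "lead_monoms ?A = insert u (lead_monoms A)"
    using lead_monoms_adjoin[OF sA(1) Suc.prems(3) m(1)] by metis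
  have uB: "u \<in> lead_monoms B - lead_monoms A" using lead_monoms_mono[OF 2] u by blast
  have "lead_monoms B - lead_monoms ?A = (lead_monoms B - lead_monoms A) - {u}" using u(2) by blast
  then have card: "l = card (lead_monoms B - lead_monoms ?A)"
    by (simp only: card_Diff_singleton[OF uB] Suc.hyps(2)[symmetric] diff_Suc_1)
  from Suc.hyps(1)[OF card 1 Suc.prems(2) 3 2] obtain N where
    N: "N 0 = ?A" "N l = B" "\<forall>i\<le>l. is_ideal (N i)" "\<forall>i<l. N i \<subset> N (Suc i)"
    unfolding card[symmetric] by blast
  have ss: "A \<subset> ?A" using subset_adjoin[of A ?b] self_in_adjoin[OF sA(1), of ?b] m(1) by blast
  show ?case unfolding Suc.hyps(2)[symmetric]
    by (rule exI[of _ "case_nat A N"])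
      (use N ss Suc.prems(1) in \<open>auto simp: less_Suc_eq_0_disj split: nat.splits\<close>)
qed

text \<open>The chain of socle extensions attains the bound; conversely each strict inclusion in a
  chain adds at least one leading monomial.\<close>

lemma Sup_chain_eq:
  fixes A B :: "('v, 'k::field) mpoly set"
  assumes AB: "is_ideal A" "is_ideal B" "cofinite_monomials A" "A \<subseteq> B"
  shows "Sup {enat l | l. \<exists>N :: nat \<Rightarrow> ('v, 'k) mpoly set. N 0 = A \<and> N l = B \<and> (\<forall>i\<le>l. is_ideal (N i)) \<and>
      (\<forall>i<l. N i \<subset> N (Suc i))} = enat (card (lead_monoms B - lead_monoms A))" (is "Sup ?X = _")
proof (rule antisym)
  show "enat (card (lead_monoms B - lead_monoms A)) \<le> Sup ?X"
    by (rule Sup_upper) (use ex_ideal_chain[OF AB] in blast)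
  show "Sup ?X \<le> enat (card (lead_monoms B - lead_monoms A))"
  proof (rule Sup_least)
    fix x assume "x \<in> ?X"
    then obtain l and N :: "nat \<Rightarrow> ('v, 'k) mpoly set"
      where x: "x = enat l" and N: "N 0 = A" "N l = B" "\<forall>i\<le>l. is_ideal (N i)" "\<forall>i<l. N i \<subset> N (Suc i)"
      by blast
    have "A \<subseteq> N i \<and> i \<le> card (lead_monoms (N i) - lead_monoms A)" if "i \<le> l" for i
      using that
    proof (induction i)
      case (Suc i)
      then have IH: "A \<subseteq> N i" "i \<le> card (lead_monoms (N i) - lead_monoms A)" by auto
      have "card (lead_monoms (N i) - lead_monoms A) < card (lead_monoms (N (Suc i)) - lead_monoms A)"
        using Suc.prems N IH(1) AB(3) by (intro card_lead_monoms_psubset is_subspace_ideal) auto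
      then show ?case using IH N Suc.prems by (auto simp: Suc_le_eq)
    qed (simp add: N)
    then show "x \<le> enat (card (lead_monoms B - lead_monoms A))" using x N(2) by auto
  qed
qed

lemma HF_eq:
  fixes I :: "('v, 'k::field) mpoly set"
  assumes "cofinite_monomials (ideal_pow I (Suc n))"
  shows "HF I n = enat (card (lead_monoms (ideal_pow I n) - lead_monoms (ideal_pow I (Suc n))))"
  unfolding HF_def
  by (rule Sup_chain_eq[OF is_ideal_ideal_pow is_ideal_ideal_pow assms ideal_pow_Suc_subset])

end

section \<open>Hilbert functions are eventually polynomial\<close>

text \<open>This is eventual agreement with a polynomial of degree less than \<open>k\<close>,
  expressed through iterated differences so that no polynomial has to be named. Values are integers
  because the differences may be negative.\<close>

primrec diff_vanishes :: "nat \<Rightarrow> (nat \<Rightarrow> int) \<Rightarrow> bool" where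
  "diff_vanishes 0 h \<longleftrightarrow> (\<forall>\<^sub>F n in sequentially. h n = 0)"
| "diff_vanishes (Suc k) h \<longleftrightarrow> diff_vanishes k (\<lambda>n. h (Suc n) - h n)"

lemma diff_vanishes_cong: "\<forall>\<^sub>F n in sequentially. g n = h n \<Longrightarrow> diff_vanishes k h \<Longrightarrow> diff_vanishes k g"
proof (induction k arbitrary: g h)
  case 0
  from 0(1) 0(2)[unfolded diff_vanishes.simps] show ?case unfolding diff_vanishes.simps by eventually_elim simp
next
  case (Suc k)
  have "\<forall>\<^sub>F n in sequentially. g (Suc n) = h (Suc n)"
    using Suc.prems(1) by (subst eventually_sequentially_Suc)
  with Suc.prems(1) have "\<forall>\<^sub>F n in sequentially. g (Suc n) - g n = h (Suc n) - h n"
    by eventually_elim simp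
  with Suc show ?case by simp
qed

lemma diff_vanishes_Suc_shift: "diff_vanishes k h \<Longrightarrow> diff_vanishes k (\<lambda>n. h (Suc n))"
proof (induction k arbitrary: h)
  case 0
  then show ?case unfolding diff_vanishes.simps by (subst eventually_sequentially_Suc)
next
  case (Suc k)
  then show ?case by simp
qed

lemma diff_vanishes_diff: "diff_vanishes k g \<Longrightarrow> diff_vanishes k h \<Longrightarrow> diff_vanishes k (\<lambda>n. g n - h n)"
proof (induction k arbitrary: g h)
  case 0
  from 0[unfolded diff_vanishes.simps] show ?case unfolding diff_vanishes.simps by eventually_elim simp
next
  case (Suc k)
  then have "diff_vanishes k (\<lambda>n. g (Suc n) - g n - (h (Suc n) - h n))" by simp
  then show ?case by (simp add: algebra_simps)
qed

lemma diff_vanishes_lift: "diff_vanishes k h \<Longrightarrow> diff_vanishes (j + k) h"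
proof (induction j)
  case (Suc j)
  then show ?case using diff_vanishes_diff[OF diff_vanishes_Suc_shift] by simp
qed simp

lemma diff_vanishes_shift: "diff_vanishes k h \<Longrightarrow> diff_vanishes k (\<lambda>n. h (n - j))"
proof (induction k arbitrary: h)
  case 0
  then obtain N where N: "\<And>n. n \<ge> N \<Longrightarrow> h n = 0"
    by (auto simp: eventually_sequentially)
  show ?case unfolding diff_vanishes.simps eventually_sequentially
    by (rule exI[of _ "N + j"]) (auto intro: N)
next
  case (Suc k)
  then have "diff_vanishes k (\<lambda>n. h (Suc (n - j)) - h (n - j))" by simp
  \<comment> \<open>Truncation in \<open>n - j\<close> disturbs only the finitely many
    \<open>n\<close> below \<open>j\<close>.\<close>
  then show ?case unfolding diff_vanishes.simps
    by (rule diff_vanishes_cong[rotated])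
      (auto simp: eventually_sequentially Suc_diff_le intro!: exI[of _ j])
qed

definition eventually_poly :: "(nat \<Rightarrow> int) \<Rightarrow> bool" where
  "eventually_poly h \<longleftrightarrow> (\<exists>k. diff_vanishes k h)"

lemma eventually_poly_diff:
  assumes "eventually_poly g" "eventually_poly h" shows "eventually_poly (\<lambda>n. g n - h n)"
proof -
  from assms obtain k l where "diff_vanishes k g" "diff_vanishes l h" by (auto simp: eventually_poly_def)
  then have "diff_vanishes (k + l) g" "diff_vanishes (k + l) h"
    using diff_vanishes_lift[of k g l] diff_vanishes_lift[of l h k] by (simp_all add: add.commute)
  then show ?thesis unfolding eventually_poly_def using diff_vanishes_diff by blast
qed

lemma eventually_poly_zero: "eventually_poly (\<lambda>n. 0)"
  unfolding eventually_poly_def by (rule exI[of _ 0]) simp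

lemma eventually_poly_add:
  assumes "eventually_poly g" "eventually_poly h" shows "eventually_poly (\<lambda>n. g n + h n)"
  using eventually_poly_diff[OF assms(1) eventually_poly_diff[OF eventually_poly_zero assms(2)]] by simp

lemma eventually_poly_sum:
  "finite S \<Longrightarrow> (\<And>i. i \<in> S \<Longrightarrow> eventually_poly (h i)) \<Longrightarrow> eventually_poly (\<lambda>n. \<Sum>i\<in>S. h i n)"
  by (induction S rule: finite_induct) (auto simp: eventually_poly_zero intro: eventually_poly_add)

lemma eventually_poly_shift: "eventually_poly h \<Longrightarrow> eventually_poly (\<lambda>n. h (n - j))"
  unfolding eventually_poly_def using diff_vanishes_shift by blast

lemma eventually_poly_cong: "\<forall>\<^sub>F n in sequentially. g n = h n \<Longrightarrow> eventually_poly h \<Longrightarrow> eventually_poly g"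
  unfolding eventually_poly_def using diff_vanishes_cong by blast

lemma eventually_poly_partial_sums:
  assumes "eventually_poly h" shows "eventually_poly (\<lambda>n. \<Sum>i\<le>n. h i)"
proof -
  obtain k where "diff_vanishes k h" using assms by (auto simp: eventually_poly_def)
  then have "diff_vanishes (Suc k) (\<lambda>n. \<Sum>i\<le>n. h i)" using diff_vanishes_Suc_shift by simp
  then show ?thesis unfolding eventually_poly_def by blast
qed

text \<open>By induction the difference of \<open>h\<close> has an eventually constant sign, so
  \<open>h\<close> is eventually monotone and from there on changes sign at most once.\<close>

lemma diff_vanishes_sign:
  "diff_vanishes k h \<Longrightarrow> (\<forall>\<^sub>F n in sequentially. 0 \<le> h n) \<or> (\<forall>\<^sub>F n in sequentially. h n < 0)"
proof (induction k arbitrary: h)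
  case 0
  then have "\<forall>\<^sub>F n in sequentially. 0 \<le> h n"
    unfolding diff_vanishes.simps by eventually_elim simp
  then show ?case by blast
next
  case (Suc k)
  from Suc.prems have "diff_vanishes k (\<lambda>n. h (Suc n) - h n)" by simp
  from Suc.IH[OF this] consider "\<forall>\<^sub>F n in sequentially. 0 \<le> h (Suc n) - h n"
    | "\<forall>\<^sub>F n in sequentially. h (Suc n) - h n < 0" by blast
  then show ?case
  proof cases
    case 1
    then obtain N where N: "\<And>n. n \<ge> N \<Longrightarrow> h n \<le> h (Suc n)" by (auto simp: eventually_sequentially)
    have mono: "h m \<le> h n" if "N \<le> m" "m \<le> n" for m n
      using that(2) by (induction n rule: dec_induct) (use N that(1) in \<open>auto intro: order_trans\<close>)
    show ?thesis
    proof (cases "\<exists>m\<ge>N. 0 \<le> h m")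
      case True
      then obtain m where "m \<ge> N" "0 \<le> h m" by blast
      then have "0 \<le> h n" if "n \<ge> m" for n using mono[of m n] that by linarith
      then show ?thesis by (auto simp: eventually_sequentially)
    next
      case False
      then have "\<forall>n\<ge>N. h n < 0" by auto
      then show ?thesis unfolding eventually_sequentially by blast
    qed
  next
    case 2
    then obtain N where N: "\<And>n. n \<ge> N \<Longrightarrow> h (Suc n) \<le> h n" by (force simp: eventually_sequentially)
    have mono: "h n \<le> h m" if "N \<le> m" "m \<le> n" for m n
      using that(2)
    proof (induction n rule: dec_induct)
      case (step n)
      then show ?case using N[of n] that(1) by linarith
    qed simp
    show ?thesis
    proof (cases "\<exists>m\<ge>N. h m < 0")
      case True
      then obtain m where "m \<ge> N" "h m < 0" by blast
      then have "h n < 0" if "n \<ge> m" for n using mono[of m n] that by linarith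
      then show ?thesis by (auto simp: eventually_sequentially)
    next
      case False
      then have "\<forall>n\<ge>N. 0 \<le> h n" by auto
      then show ?thesis unfolding eventually_sequentially by blast
    qed
  qed
qed

text \<open>The increments have an eventually constant sign, and eventually negative ones would
  drive the integer sequence \<open>q\<close> below zero.\<close>

lemma eventually_poly_increments_nonneg:
  fixes q :: "nat \<Rightarrow> int"
  assumes "eventually_poly (\<lambda>n. q (Suc n) - q n)" "\<And>n. 0 \<le> q n"
  shows "\<forall>\<^sub>F n in sequentially. q n \<le> q (Suc n)"
proof -
  have "\<not> (\<forall>\<^sub>F n in sequentially. q (Suc n) - q n < 0)"
  proof
    assume "\<forall>\<^sub>F n in sequentially. q (Suc n) - q n < 0"
    then obtain N where N: "\<And>n. n \<ge> N \<Longrightarrow> q (Suc n) < q n" by (auto simp: eventually_sequentially)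
    have "q (N + i) \<le> q N - int i" for i
    proof (induction i)
      case (Suc i)
      then show ?case using N[of "N + i"] by simp
    qed simp
    from this[of "Suc (nat (q N))"] assms(2)[of N] assms(2)[of "N + Suc (nat (q N))"]
    show False by simp
  qed
  then show ?thesis using assms(1) diff_vanishes_sign unfolding eventually_poly_def by fastforce
qed

section \<open>Counting the complement of an upset of exponent lists\<close>

definition uplist :: "nat \<Rightarrow> nat list set \<Rightarrow> bool" where
  "uplist s U \<longleftrightarrow> (\<forall>l\<in>U. length l = s) \<and> (\<forall>a b. length a = s \<longrightarrow> b \<in> U \<longrightarrow> map2 (+) a b \<in> U)"

text \<open>Fixing the first exponent lowers the number of variables by one. Lists are chosen over
  exponent functions for this induction and for their lexicographic order.\<close>

definition slice :: "nat \<Rightarrow> nat list set \<Rightarrow> nat list set" where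
  "slice i U = {l. i # l \<in> U}"

lemma uplist_slice: "uplist (Suc s) U \<Longrightarrow> uplist s (slice i U)"
  unfolding uplist_def slice_def
proof (intro conjI ballI allI impI CollectI; elim conjE CollectE)
  fix l assume "\<forall>l\<in>U. length l = Suc s" "i # l \<in> U"
  then show "length l = s" by auto
next
  fix a b :: "nat list" assume "\<forall>a b. length a = Suc s \<longrightarrow> b \<in> U \<longrightarrow> map2 (+) a b \<in> U"
    "length a = s" "i # b \<in> U"
  then have "map2 (+) (0 # a) (i # b) \<in> U" by (metis length_Cons)
  then show "i # map2 (+) a b \<in> U" by simp
qed

lemma map2_add_replicate_0: "length l = s \<Longrightarrow> map2 (+) (replicate s 0) l = (l :: nat list)"
  by (induction l arbitrary: s) auto

lemma slice_mono:
  assumes "uplist (Suc s) U" "i \<le> j" shows "slice i U \<subseteq> slice j U"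
proof
  fix l assume "l \<in> slice i U"
  then have l: "i # l \<in> U" "length l = s" using assms(1) by (auto simp: slice_def uplist_def)
  then have "map2 (+) ((j - i) # replicate s 0) (i # l) \<in> U"
    using assms(1) unfolding uplist_def by (metis length_Cons length_replicate)
  then show "l \<in> slice j U" using l assms(2) by (simp add: slice_def map2_add_replicate_0)
qed

text \<open>Noetherianity of \<open>\<nat>\<^sup>s\<close>: for \<open>s + 1\<close>, stabilise first the diagonal of the slices
  \<open>slice i (U j)\<close> and then the finitely many rows below the stabilisation index.\<close>
lemma uplist_chain_stabilizes:
  assumes "\<And>j. uplist s (U j)" "\<And>j. U j \<subseteq> U (Suc j)"
  shows "\<exists>p. \<forall>j\<ge>p. U j = U p"
  using assms
proof (induction s arbitrary: U)
  case 0
  have mono: "U i \<subseteq> U j" if "i \<le> j" for i j using 0(2) that by (rule lift_Suc_mono_le)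
  have sub: "U j \<subseteq> {[]}" for j using 0(1)[of j] by (auto simp: uplist_def)
  show ?case
  proof (cases "\<exists>p. U p \<noteq> {}")
    case True
    then obtain p where "U p = {[]}" using sub by blast
    then show ?thesis using mono sub by blast
  qed auto
next
  case (Suc s)
  have mono: "U i \<subseteq> U j" if "i \<le> j" for i j
    using Suc.prems(2) that by (rule lift_Suc_mono_le)
  have sl: "uplist s (slice i (U j))" for i j by (rule uplist_slice[OF Suc.prems(1)])
  have smono: "slice i (U j) \<subseteq> slice i' (U j')" if "i \<le> i'" "j \<le> j'" for i i' j j'
    using slice_mono[OF Suc.prems(1) that(1), of j] mono[OF that(2)] by (auto simp: slice_def)
  have "\<exists>p. \<forall>j\<ge>p. slice j (U j) = slice p (U p)"
    using sl by (rule Suc.IH) (rule smono; simp)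
  then obtain p where p: "\<And>j. j \<ge> p \<Longrightarrow> slice j (U j) = slice p (U p)" by blast
  have "\<exists>q. \<forall>j\<ge>q. slice i (U j) = slice i (U q)" for i
    using sl by (rule Suc.IH) (rule smono; simp)
  then obtain q where q: "\<And>i j. j \<ge> q i \<Longrightarrow> slice i (U j) = slice i (U (q i))" by metis
  define P where "P = Max (insert p (q ` {..<p}))"
  have P: "p \<le> P" "\<And>i. i < p \<Longrightarrow> q i \<le> P" by (auto simp: P_def)
  have eq: "slice i (U j) = slice i (U P)" if j: "j \<ge> P" for i j
  proof (cases "i < p")
    case True
    then show ?thesis using q[of i j] q[of i P] P(2)[OF True] j by simp
  next
    case False
    \<comment> \<open>For \<open>i\<close> at least \<open>p\<close>, the slice lies between
      \<open>slice p (U p)\<close> and the diagonal slice at \<open>max i j'\<close>, and these two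
      are equal by the choice of \<open>p\<close>.\<close>
    have "slice i (U j') = slice p (U p)" if "p \<le> j'" for j'
    proof
      show "slice p (U p) \<subseteq> slice i (U j')" using False that by (intro smono) auto
      have "slice i (U j') \<subseteq> slice (max i j') (U (max i j'))" by (intro smono) auto
      then show "slice i (U j') \<subseteq> slice p (U p)" using p[of "max i j'"] that by simp
    qed
    then show ?thesis using P(1) j by simp
  qed
  have "U j = U P" if "j \<ge> P" for j
  proof (rule set_eqI)
    fix l show "l \<in> U j \<longleftrightarrow> l \<in> U P"
    proof (cases l)
      case Nil
      then show ?thesis using Suc.prems(1)[of j] Suc.prems(1)[of P] by (auto simp: uplist_def)
    next
      case (Cons i l')
      then show ?thesis using eq[OF that, of i] by (auto simp: slice_def)
    qed
  qed
  then show ?case by blast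
qed

definition compositions :: "nat \<Rightarrow> nat \<Rightarrow> nat list set" where
  "compositions s n = {l. length l = s \<and> sum_list l = n}"

lemma finite_compositions: "finite (compositions s n)"
proof (rule finite_subset)
  show "compositions s n \<subseteq> {l. set l \<subseteq> {..n} \<and> length l = s}"
    by (auto simp: compositions_def intro: member_le_sum_list)
qed (rule finite_lists_length_eq; simp)

lemma card_compositions_Suc:
  "card (compositions (Suc s) n - U) = (\<Sum>j\<le>n. card (compositions s (n - j) - slice j U))"
proof -
  have "compositions (Suc s) n - U =
      (\<lambda>(j, l). j # l) ` (SIGMA j:{..n}. compositions s (n - j) - slice j U)" (is "?L = ?f ` ?R")
  proof (intro equalityI subsetI)
    fix x assume "x \<in> ?L"
    then obtain j l where "x = j # l" "length l = s" "j + sum_list l = n" "j # l \<notin> U"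
      by (cases x) (auto simp: compositions_def)
    then show "x \<in> ?f ` ?R" by (intro image_eqI[of _ _ "(j, l)"]) (auto simp: compositions_def slice_def)
  qed (auto simp: compositions_def slice_def)
  moreover have "inj_on ?f ?R" by (auto simp: inj_on_def)
  ultimately show ?thesis by (simp add: card_image card_SigmaI finite_compositions)
qed

text \<open>This is the Hilbert function of a monomial ideal. Splitting by the first exponent
  expresses it through the slices, which are constant from some \<open>p\<close> on: those below
  \<open>p\<close> give finitely many shifted terms, the others a partial sum.\<close>

lemma eventually_poly_card_compl_uplist: "uplist s U \<Longrightarrow> eventually_poly (\<lambda>n. int (card (compositions s n - U)))"
proof (induction s arbitrary: U)
  case 0
  have "\<forall>\<^sub>F n in sequentially. int (card (compositions 0 n - U)) = 0"
    unfolding eventually_sequentially by (rule exI[of _ 1]) (auto simp: compositions_def)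
  from this eventually_poly_zero show ?case by (rule eventually_poly_cong)
next
  case (Suc s)
  let ?h = "\<lambda>j n. int (card (compositions s n - slice j U))"
  have h: "eventually_poly (?h j)" for j using Suc.IH uplist_slice[OF Suc.prems] by blast
  have "\<exists>p. \<forall>j\<ge>p. slice j U = slice p U"
    using uplist_slice[OF Suc.prems] by (rule uplist_chain_stabilizes) (rule slice_mono[OF Suc.prems]; simp)
  then obtain p where p: "\<And>j. j \<ge> p \<Longrightarrow> slice j U = slice p U" by blast
  have "eventually_poly (\<lambda>n. (\<Sum>j<p. ?h j (n - j)) + (\<Sum>i\<le>n - p. ?h p i))"
    by (intro eventually_poly_add eventually_poly_sum eventually_poly_shift eventually_poly_shift[of "\<lambda>n. \<Sum>i\<le>n. ?h p i"]
        eventually_poly_partial_sums h) simp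
  moreover have "int (card (compositions (Suc s) n - U)) = (\<Sum>j<p. ?h j (n - j)) + (\<Sum>i\<le>n - p. ?h p i)"
    if n: "n \<ge> p" for n
  proof -
    have "{..n} = {..<p} \<union> {p..n}" "{..<p} \<inter> {p..n} = {}" using n by auto
    then have "int (card (compositions (Suc s) n - U)) = (\<Sum>j<p. ?h j (n - j)) + (\<Sum>j=p..n. ?h j (n - j))"
      by (simp add: card_compositions_Suc sum.union_disjoint)
    also have "(\<Sum>j=p..n. ?h j (n - j)) = (\<Sum>j=p..n. ?h p (n - j))"
    proof (rule sum.cong[OF refl])
      fix j assume "j \<in> {p..n}"
      then have "slice j U = slice p U" by (intro p) simp
      then show "?h j (n - j) = ?h p (n - j)" by (simp only:)
    qed
    also have "\<dots> = (\<Sum>i\<le>n - p. ?h p i)"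
      by (rule sum.reindex_bij_witness[of _ "\<lambda>i. n - i" "\<lambda>j. n - j"]) (use n in auto)
    finally show ?thesis .
  qed
  ultimately show ?case
    by (elim eventually_poly_cong[rotated]) (auto simp: eventually_sequentially)
qed

text \<open>This keeps lexicographic predecessors predecessors when a linear relation is multiplied
  by a monomial in the generators.\<close>

lemma map2_add_less:
  fixes a b d :: "nat list"
  assumes "length a = length b" "length d = length a" "a < b"
  shows "map2 (+) d a < map2 (+) d b"
  using assms
proof (induction a b arbitrary: d rule: list_induct2)
  case (Cons x a y b)
  then show ?case by (cases d) auto
qed simp

lemma length_sum_map2_add:
  "length d = length a \<Longrightarrow> sum_list (map2 (+) d a) = sum_list d + sum_list (a :: nat list)"
  by (induction d a rule: list_induct2) auto

section \<open>Monomials in a list of generators\<close>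

fun eval_monom :: "'a::comm_ring_1 list \<Rightarrow> nat list \<Rightarrow> 'a" where
  "eval_monom (a # as) (i # l) = a ^ i * eval_monom as l"
| "eval_monom _ _ = 1"

lemma eval_monom_add:
  "length d = length l \<Longrightarrow> length as = length l \<Longrightarrow>
    eval_monom as (map2 (+) d l) = eval_monom as d * eval_monom as l"
proof (induction d l arbitrary: as rule: list_induct2)
  case (Cons x d y l)
  then show ?case by (cases as) (auto simp: power_add)
qed simp

lemma eval_monom_in_ideal_pow:
  "length l = length as \<Longrightarrow> set as \<subseteq> J \<Longrightarrow> eval_monom as l \<in> ideal_pow J (sum_list l)"
proof (induction l as rule: list_induct2)
  case (Cons i l a as)
  then show ?case
    using ideal_pow_mult[OF power_in_ideal_pow[of a J i], of "eval_monom as l" "sum_list l"] by simp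
qed simp

lemma mult_eval_monom:
  assumes "a \<in> set as" "length l = length as"
  obtains l' where "length l' = length as" "sum_list l' = Suc (sum_list l)"
    "a * eval_monom as l = eval_monom as l'"
proof -
  have "\<exists>l'. length l' = length as \<and> sum_list l' = Suc (sum_list l) \<and> a * eval_monom as l = eval_monom as l'"
    using assms(2,1)
  proof (induction l as rule: list_induct2)
    case (Cons i l b as)
    show ?case
    proof (cases "a = b")
      case True
      then show ?thesis by (intro exI[of _ "Suc i # l"]) (use Cons in \<open>auto simp: mult.assoc\<close>)
    next
      case False
      with Cons obtain l' where l': "length l' = length as" "sum_list l' = Suc (sum_list l)"
        "a * eval_monom as l = eval_monom as l'" by auto
      then have "a * (b ^ i * eval_monom as l) = b ^ i * eval_monom as l'"
        by (metis mult.left_commute)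
      with l' show ?thesis by (intro exI[of _ "i # l'"]) auto
    qed
  qed simp
  with that show ?thesis by blast
qed

text \<open>A product of two ideals can be tested on generators of both factors, and multiplying a
  monomial in the list by one of the entries raises a single exponent by one.\<close>

lemma ideal_pow_subset_eval_monom:
  fixes as :: "'a::comm_ring_1 list"
  shows "ideal_pow (ideal_gen (set as)) n \<subseteq> ideal_gen (eval_monom as ` compositions (length as) n)"
proof (induction n)
  case 0
  have "eval_monom as (replicate (length as) 0) = 1" by (induction as) auto
  moreover have "replicate (length as) 0 \<in> compositions (length as) 0" by (simp add: compositions_def)
  ultimately have "1 \<in> eval_monom as ` compositions (length as) 0" by (metis image_eqI)
  then have "1 \<in> ideal_gen (eval_monom as ` compositions (length as) 0)"
    by (rule subsetD[OF ideal_gen_superset])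
  then have "r * 1 \<in> ideal_gen (eval_monom as ` compositions (length as) 0)" for r
    by (rule is_idealD(3)[OF is_ideal_ideal_gen])
  then show ?case by auto
next
  case (Suc n)
  let ?G = "\<lambda>n. ideal_gen (eval_monom as ` compositions (length as) n)"
  have "a * b \<in> ?G (Suc n)" if ab: "a \<in> set as" "b \<in> eval_monom as ` compositions (length as) n" for a b
  proof -
    from ab(2) obtain l where l: "b = eval_monom as l" "length l = length as" "sum_list l = n"
      by (auto simp: compositions_def)
    obtain l' where "length l' = length as" "sum_list l' = Suc (sum_list l)"
      "a * eval_monom as l = eval_monom as l'" using mult_eval_monom[OF ab(1) l(2)] by metis
    then have "a * b \<in> eval_monom as ` compositions (length as) (Suc n)"
      using l by (auto simp: compositions_def)
    then show ?thesis by (rule subsetD[OF ideal_gen_superset])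
  qed
  from ideal_gen_mult_subset[OF is_ideal_ideal_gen this]
  have "a * b \<in> ?G (Suc n)" if "a \<in> ideal_gen (set as)" "b \<in> ?G n" for a b
    using that by blast
  then show ?case unfolding ideal_pow.simps
    by (intro ideal_gen_minimal is_ideal_ideal_gen) (use Suc in blast)
qed

section \<open>Ideals containing a power of every variable\<close>

lemma var_power: "(var v :: ('v, 'k::comm_ring_1) mpoly) ^ n = mon (Poly_Mapping.single v n)"
  by (induction n) (simp_all add: var_def mult_single flip: single_add)

lemma finite_bounded_monomials: "finite {m :: 'v::finite \<Rightarrow>\<^sub>0 nat. \<forall>v. lookup m v \<le> N v}"
proof -
  let ?M = "{m :: 'v \<Rightarrow>\<^sub>0 nat. \<forall>v. lookup m v \<le> N v}"
  let ?F = "{f :: 'v \<Rightarrow> nat. \<forall>v. (v \<in> UNIV \<longrightarrow> f v \<in> {..Max (range N)}) \<and> (v \<notin> UNIV \<longrightarrow> f v = 0)}"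
  have "lookup m v \<le> Max (range N)" if "m \<in> ?M" for m v
  proof -
    have "lookup m v \<le> N v" using that by auto
    also have "\<dots> \<le> Max (range N)" by simp
    finally show ?thesis .
  qed
  then have "lookup ` ?M \<subseteq> ?F" by auto
  then have "finite (lookup ` ?M)" by (rule finite_subset) (intro finite_set_of_finite_funs; simp)
  then show ?thesis by (rule finite_imageD) (auto simp: inj_on_def intro: poly_mapping_eqI)
qed

text \<open>A monomial outside the box with sides \<open>N v\<close> is divisible by one of the
  given powers, so only monomials in the box can be missing from \<open>K\<close>.\<close>

lemma cofinite_monomials_var_powers:
  fixes K :: "('v::finite, 'k::comm_ring_1) mpoly set"
  assumes K: "is_ideal K" and N: "\<And>v. var v ^ N v \<in> K"
  shows "cofinite_monomials K"
proof -
  let ?M = "{m :: 'v \<Rightarrow>\<^sub>0 nat. \<forall>v. lookup m v \<le> N v}"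
  have "finite ?M" by (rule finite_bounded_monomials)
  moreover have "(mon m :: ('v, 'k) mpoly) \<in> K" if "m \<notin> ?M" for m
  proof -
    from that obtain v where "N v \<le> lookup m v" by (auto simp: not_le dest: less_imp_le)
    then have m: "m = (m - Poly_Mapping.single v (N v)) + Poly_Mapping.single v (N v)"
      by (intro poly_mapping_eqI) (auto simp: lookup_add lookup_minus lookup_single when_def)
    have "mon (m - Poly_Mapping.single v (N v)) * var v ^ N v \<in> K"
      by (rule is_idealD(3)[OF K N])
    then show ?thesis by (subst m) (simp add: var_power mult_single)
  qed
  ultimately show ?thesis unfolding cofinite_monomials_def by (elim finite_subset[rotated]) auto
qed

lemma cofinite_monomials_ideal_pow:
  fixes I :: "('v::finite, 'k::comm_ring_1) mpoly set"
  assumes "\<And>v. var v ^ N v \<in> I"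
  shows "cofinite_monomials (ideal_pow I n)"
proof (rule cofinite_monomials_var_powers[OF is_ideal_ideal_pow])
  show "var v ^ (N v * n) \<in> ideal_pow I n" for v
    using power_in_ideal_pow[OF assms, of v n] by (simp add: power_mult)
qed

context monomial_order
begin

text \<open>The products \<open>a\<^sup>\<alpha> b\<^sub>j\<close> of degree \<open>n\<close>, with \<open>a\<close> running over generators of \<open>I\<close> and \<open>b\<close>
  spanning \<open>R\<close> modulo \<open>I\<close>, span \<open>I\<^sup>n\<close> modulo \<open>I\<^sup>n\<^sup>+\<^sup>1\<close>. Those lying in the span of their
  lexicographic predecessors form, for each \<open>j\<close>, an upset of exponents \<open>\<alpha>\<close>.\<close>
lemma eventually_poly_card_lead_monoms:
  fixes I :: "('v, 'k::field) mpoly set"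
  assumes gens: "I = ideal_gen (set as)" and cof: "\<And>n. cofinite_monomials (ideal_pow I n)"
    and e: "span_over I e {..<m::nat} = UNIV"
  shows "eventually_poly (\<lambda>n. int (card (lead_monoms (ideal_pow I n) - lead_monoms (ideal_pow I (Suc n)))))"
proof -
  let ?s = "length as"
  let ?I = "ideal_pow I"
  define T where "T n = compositions ?s n \<times> {..<m}" for n
  define f where "f t = eval_monom as (fst t) * e (snd t)" for t
  have I: "is_ideal I" unfolding gens by (rule is_ideal_ideal_gen)
  have subI: "is_subspace (?I n)" for n by (intro is_subspace_ideal is_ideal_ideal_pow)
  have fT: "finite (T n)" for n by (simp add: T_def finite_compositions)
  have fT': "finite {t' \<in> T n. t' < t}" for n t using fT by simp
  have asI: "set as \<subseteq> I" unfolding gens by (rule ideal_gen_superset)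
  have me: "eval_monom as l \<in> ?I n" if "l \<in> compositions ?s n" for l n
    using eval_monom_in_ideal_pow[of l as I] that asI by (auto simp: compositions_def)
  have fI: "f t \<in> ?I n" if "t \<in> T n" for t n
    unfolding f_def using that me by (intro is_idealD(4)[OF is_ideal_ideal_pow]) (auto simp: T_def)
  have span: "span_over (?I (Suc n)) f (T n) = ?I n" for n
  proof
    let ?P = "span_over (?I (Suc n)) f (T n)"
    show "?P \<subseteq> ?I n" by (intro span_over_subset subI ideal_pow_Suc_subset fI)
    have P: "is_subspace ?P" by (intro is_subspace_span_over fT subI)
    \<comment> \<open>The coefficient \<open>x\<close> is reduced modulo \<open>I\<close>: its part
      in \<open>I\<close> carries the product into \<open>?I (Suc n)\<close>, and the rest is a
      scalar combination of the \<open>e j\<close>.\<close>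
    have xme: "x * eval_monom as l \<in> ?P" if l: "l \<in> compositions ?s n" for x l
    proof -
      have "x \<in> span_over I e {..<m}" using e by simp
      then obtain i c where i: "i \<in> I" "x = i + (\<Sum>j<m. cst (c j) * e j)" unfolding span_over_def by blast
      have "i * eval_monom as l \<in> ?P"
        using ideal_pow_Suc_mult[OF i(1) me[OF l]] subset_span_over by blast
      moreover have "(\<Sum>j<m. cst (c j) * f (l, j)) \<in> ?P"
        using l by (intro is_subspace_sum[OF P] is_subspaceD(3)[OF P] in_span_over fT subI) (auto simp: T_def)
      ultimately have "i * eval_monom as l + (\<Sum>j<m. cst (c j) * f (l, j)) \<in> ?P"
        by (rule is_subspaceD(2)[OF P])
      then show ?thesis by (simp add: i(2) f_def sum_distrib_left algebra_simps)
    qed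
    have "r * y \<in> ?P" if "y \<in> ?P" for r y
    proof -
      from that obtain a c where a: "a \<in> ?I (Suc n)" "y = a + (\<Sum>t\<in>T n. cst (c t) * f t)"
        unfolding span_over_def by blast
      have "r * a \<in> ?P" using is_idealD(3)[OF is_ideal_ideal_pow a(1)] subset_span_over by blast
      moreover have "(\<Sum>t\<in>T n. (r * cst (c t) * e (snd t)) * eval_monom as (fst t)) \<in> ?P"
        by (intro is_subspace_sum[OF P] xme) (auto simp: T_def)
      ultimately have "r * a + (\<Sum>t\<in>T n. (r * cst (c t) * e (snd t)) * eval_monom as (fst t)) \<in> ?P"
        by (rule is_subspaceD(2)[OF P])
      then show ?thesis by (simp add: a(2) f_def sum_distrib_left algebra_simps)
    qed
    then have "is_ideal ?P" using P unfolding is_ideal_def is_subspace_def by blast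
    moreover have "eval_monom as ` compositions ?s n \<subseteq> ?P" using xme[of _ 1] by auto
    ultimately have "ideal_gen (eval_monom as ` compositions ?s n) \<subseteq> ?P" by (rule ideal_gen_minimal)
    then show "?I n \<subseteq> ?P" using ideal_pow_subset_eval_monom[of as n] unfolding gens by blast
  qed
  define Sp where "Sp n t = span_over (?I (Suc n)) f {t' \<in> T n. t' < t}" for n t
  \<comment> \<open>The degree is read off from \<open>l\<close>, so a single set \<open>W j\<close>
    serves all \<open>n\<close>; its complement in degree \<open>n\<close> indexes the products with
    \<open>e j\<close> that add a dimension.\<close>
  define W where "W j = {l. length l = ?s \<and> f (l, j) \<in> Sp (sum_list l) (l, j)}" for j
  have card: "card (lead_monoms (?I n) - lead_monoms (?I (Suc n))) = (\<Sum>j<m. card (compositions ?s n - W j))" for n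
  proof -
    have "card (lead_monoms (?I n) - lead_monoms (?I (Suc n))) = card {t \<in> T n. f t \<notin> Sp n t}"
      using card_lead_monoms_span_over[of "T n" "?I (Suc n)" f, OF fT subI cof] unfolding span Sp_def .
    also have "{t \<in> T n. f t \<notin> Sp n t} = (\<lambda>(j, l). (l, j)) ` (SIGMA j:{..<m}. compositions ?s n - W j)"
      by (auto simp: T_def W_def compositions_def image_iff)
    also have "card \<dots> = (\<Sum>j<m. card (compositions ?s n - W j))"
      by (subst card_image) (auto simp: inj_on_def card_SigmaI finite_compositions)
    finally show ?thesis .
  qed
  have "uplist ?s (W j)" for j
    unfolding uplist_def
  proof (intro conjI ballI allI impI)
    fix d l :: "nat list" assume d: "length d = ?s" and "l \<in> W j"
    then have l: "length l = ?s" "f (l, j) \<in> Sp (sum_list l) (l, j)" by (auto simp: W_def)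
    let ?n = "sum_list l" and ?l' = "map2 (+) d l"
    let ?P = "Sp (sum_list ?l') (?l', j)"
    have n': "sum_list ?l' = sum_list d + ?n" using d l by (simp add: length_sum_map2_add)
    have P: "is_subspace ?P" unfolding Sp_def by (intro is_subspace_span_over fT' subI)
    from l(2) obtain a c where a: "a \<in> ?I (Suc ?n)"
      "f (l, j) = a + (\<Sum>t\<in>{t' \<in> T ?n. t' < (l, j)}. cst (c t) * f t)"
      unfolding Sp_def span_over_def by blast
    have shift: "eval_monom as d * f (l', j') = f (map2 (+) d l', j')" if "length l' = ?s" for l' j'
      using that d by (simp add: f_def eval_monom_add mult.assoc)
    \<comment> \<open>The relation for \<open>(l, j)\<close> is multiplied by the monomial with
      exponents \<open>d\<close>. The remainder \<open>a\<close> gains \<open>sum_list d\<close> in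
      degree and thus lands in the power of \<open>I\<close> that is contained in
      \<open>?P\<close>.\<close>
    have "eval_monom as d \<in> ?I (sum_list d)"
      using me[of d "sum_list d"] d by (simp add: compositions_def)
    then have "eval_monom as d * a \<in> ?I (sum_list d + Suc ?n)"
      using a(1) by (rule ideal_pow_mult)
    then have "eval_monom as d * a \<in> ?I (Suc (sum_list ?l'))"
      by (simp only: n' add_Suc_right)
    then have 1: "eval_monom as d * a \<in> ?P"
      unfolding Sp_def by (rule subsetD[OF subset_span_over])
    have "eval_monom as d * f t \<in> ?P" if t: "t \<in> {t' \<in> T ?n. t' < (l, j)}" for t
    proof -
      obtain l' j' where t': "t = (l', j')" by force
      then have l': "length l' = ?s" "sum_list l' = ?n" "j' < m" "l' < l \<or> l' = l \<and> j' < j"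
        using t by (auto simp: T_def compositions_def)
      have "(map2 (+) d l', j') \<in> T (sum_list ?l')"
        using l' d by (auto simp: T_def compositions_def n' length_sum_map2_add)
      \<comment> \<open>Pairs are compared by exponents first and by the index of \<open>e\<close>
        second; the shift respects both cases.\<close>
      moreover have "(map2 (+) d l', j') < (?l', j)"
        using l'(4) map2_add_less[of l' l d] l' l d by auto
      ultimately show ?thesis unfolding t' shift[OF l'(1)] Sp_def
        by (intro in_span_over fT' subI) auto
    qed
    then have "(\<Sum>t\<in>{t' \<in> T ?n. t' < (l, j)}. cst (c t) * (eval_monom as d * f t)) \<in> ?P"
      by (intro is_subspace_sum[OF P] is_subspaceD(3)[OF P])
    from is_subspaceD(2)[OF P 1 this] have "eval_monom as d * f (l, j) \<in> ?P"
      by (simp add: a(2) distrib_left sum_distrib_left mult.left_commute)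
    then show "?l' \<in> W j" using shift[OF l(1)] d l by (simp add: W_def)
  qed (simp add: W_def)
  then have "eventually_poly (\<lambda>n. \<Sum>j<m. int (card (compositions ?s n - W j)))"
    by (intro eventually_poly_sum eventually_poly_card_compl_uplist) auto
  then show ?thesis by (simp only: card of_nat_sum)
qed

text \<open>The powers of the variables generate an ideal of finite codimension inside
  \<open>I\<close>, and finitely many further elements span \<open>I\<close> over it. Finite
  generation of \<open>I\<close> thus comes from linear algebra.\<close>

lemma eventually_poly_card_lead_monoms_var_powers:
  fixes I :: "('v, 'k::field) mpoly set"
  assumes I: "is_ideal I" and N: "\<And>v. var v ^ N v \<in> I"
  shows "eventually_poly (\<lambda>n. int (card (lead_monoms (ideal_pow I n) - lead_monoms (ideal_pow I (Suc n)))))"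
proof -
  let ?X = "range (\<lambda>v. var v ^ N v :: ('v, 'k) mpoly)"
  let ?K = "ideal_gen ?X"
  have K: "is_ideal ?K" by (rule is_ideal_ideal_gen)
  have KI: "?K \<subseteq> I" using I N by (intro ideal_gen_minimal) auto
  have cK: "cofinite_monomials ?K"
    by (rule cofinite_monomials_var_powers[OF K, of N]) (rule subsetD[OF ideal_gen_superset], simp)
  have cI: "cofinite_monomials I" using cK KI by (rule cofinite_monomials_mono)
  obtain e and m :: nat where e: "\<forall>j<m. e j \<in> I" "I = span_over ?K e {..<m}"
    using ex_finite_span_over[OF is_subspace_ideal[OF K] cK is_subspace_ideal[OF I] KI] by blast
  obtain as where as: "set as = ?X \<union> e ` {..<m}"
    using finite_list[of "?X \<union> e ` {..<m}"] by auto
  have "I = ideal_gen (set as)"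
  proof
    show "ideal_gen (set as) \<subseteq> I" using as e(1) N by (intro ideal_gen_minimal I) auto
    have "?K \<subseteq> ideal_gen (set as)"
      using as ideal_gen_superset[of "set as"] by (intro ideal_gen_minimal is_ideal_ideal_gen) auto
    moreover have "e j \<in> ideal_gen (set as)" if "j < m" for j
      using as ideal_gen_superset[of "set as"] that by auto
    ultimately have "span_over ?K e {..<m} \<subseteq> ideal_gen (set as)"
      by (intro span_over_subset is_subspace_ideal is_ideal_ideal_gen) auto
    then show "I \<subseteq> ideal_gen (set as)" using e(2) by simp
  qed
  moreover obtain e' and m' :: nat where "UNIV = span_over I e' {..<m'}"
    using ex_finite_span_over[OF is_subspace_ideal[OF I] cI is_subspace_ideal, of UNIV] by (auto simp: is_ideal_def)
  ultimately show ?thesis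
    using eventually_poly_card_lead_monoms[of I as e' m'] cofinite_monomials_ideal_pow[of N I] N by metis
qed

end

section \<open>Comparison with the initial ideal\<close>

lemma monom_pow_antimono: "m \<le> n \<Longrightarrow> monom_pow U n \<subseteq> monom_pow U m"
proof (induction n rule: dec_induct)
  case (step n)
  have "monom_pow U (Suc n) \<subseteq> monom_pow U n" using upset_monom_pow[of U n] by (auto simp: upset_def)
  then show ?case using step by blast
qed simp

text \<open>Otherwise some multiple of \<open>u\<close> is a nonzero element of \<open>gr\<^sub>J(R)\<close> killed by the whole
  homogeneous maximal ideal.\<close>
lemma gr_depth_pos_colon:
  fixes U :: "('v::finite \<Rightarrow>\<^sub>0 nat) set" and J :: "('v, 'k::comm_ring_1) mpoly set"
  assumes U: "upset U" and J: "J = mon_span U" and depth: "gr_depth_pos J"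
    and cof: "\<And>n. cofinite_monomials (ideal_pow J n)"
    and u: "\<And>s. s \<in> U \<Longrightarrow> s + u \<in> monom_pow U (Suc n)"
  shows "u \<in> monom_pow U n"
proof (rule ccontr)
  assume un: "u \<notin> monom_pow U n"
  let ?I = "ideal_pow J"
  have I: "?I k = mon_span (monom_pow U k)" for k unfolding J by (rule ideal_pow_mon_span[OF U])
  have id: "is_ideal (?I k)" for k by (rule is_ideal_ideal_pow)
  \<comment> \<open>The least such \<open>k\<close> is positive and fixes the degree
    \<open>p = k - 1\<close> in which \<open>u\<close> has a nonzero class in the graded
    ring.\<close>
  define k where "k = (LEAST k. u \<notin> monom_pow U k)"
  have k: "u \<notin> monom_pow U k" "k \<le> n" "\<And>l. l < k \<Longrightarrow> u \<in> monom_pow U l"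
    unfolding k_def using LeastI[of "\<lambda>k. u \<notin> monom_pow U k", OF un] Least_le[of "\<lambda>k. u \<notin> monom_pow U k", OF un]
      not_less_Least by blast+
  then obtain p where kp: "k = Suc p" by (cases k) auto
  have up: "u \<in> monom_pow U p" using k(3) kp by simp
  have "(mon u :: ('v, 'k) mpoly) \<notin> ?I (Suc p)" using k(1) unfolding kp I by simp
  then obtain m where m: "mon m * mon u \<notin> ?I (Suc p)"
    "\<And>m'. m' \<noteq> 0 \<Longrightarrow> mon m' * (mon m * mon u) \<in> ?I (Suc p)"
    using ex_socle_multiple[OF id cof] by metis
  \<comment> \<open>The class of \<open>w\<close> in degree \<open>p\<close> is nonzero, is
    annihilated by the variables and, as a multiple of \<open>mon u\<close>, will also be
    annihilated by the part of degree one.\<close>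
  define w :: "('v, 'k) mpoly" where "w = mon m * mon u"
  have "mon u \<in> ?I p" using up by (simp add: I)
  then have wp: "w \<in> ?I p" unfolding w_def by (rule is_idealD(3)[OF id])
  have colon: "is_ideal {x. \<forall>y\<in>{w}. x * y \<in> ?I l}" for l
    by (rule is_ideal_colon[OF id])
  \<comment> \<open>The hypothesis on \<open>u\<close> reaches the power \<open>n + 1\<close>, and
    \<open>p + 2\<close> does not exceed it.\<close>
  have Jw: "a * w \<in> ?I (Suc (Suc p))" if "a \<in> J" for a
  proof -
    have "a \<in> {x. \<forall>y\<in>{w}. x * y \<in> ?I (Suc (Suc p))}"
    proof (rule is_subspace_monomials[OF is_subspace_ideal[OF colon]])
      fix s assume "s \<in> keys a"
      then have "s \<in> U" using that by (auto simp: J mon_span_def)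
      then have "s + u \<in> monom_pow U (Suc n)" by (rule u)
      then have "s + u \<in> monom_pow U (Suc (Suc p))"
        by (rule subsetD[OF monom_pow_antimono, rotated]) (use k(2) kp in simp)
      then have "(mon (s + u) :: ('v, 'k) mpoly) \<in> ?I (Suc (Suc p))" unfolding I by simp
      then have "mon m * (mon (s + u) :: ('v, 'k) mpoly) \<in> ?I (Suc (Suc p))" by (rule is_idealD(3)[OF id])
      moreover have "mon m * mon (s + u) = mon s * w" by (simp add: w_def mult_single ac_simps)
      ultimately show "mon s \<in> {x. \<forall>y\<in>{w}. x * y \<in> ?I (Suc (Suc p))}" by simp
    qed
    then show ?thesis by simp
  qed
  have IJw: "x * w \<in> ?I (Suc (i + p))" if "x \<in> ?I i" "0 < i" for x i
  proof -
    obtain i' where i: "i = Suc i'" using \<open>0 < i\<close> by (cases i) auto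
    have "?I (Suc i') \<subseteq> {x. \<forall>y\<in>{w}. x * y \<in> ?I (Suc (i + p))}"
      unfolding ideal_pow.simps(2)[of J i']
    proof (rule ideal_gen_minimal[OF colon], rule subsetI)
      fix x assume "x \<in> {a * b |a b. a \<in> J \<and> b \<in> ?I i'}"
      then obtain a b where x: "x = a * b" "a \<in> J" "b \<in> ?I i'" by blast
      have "b * (a * w) \<in> ?I (i' + Suc (Suc p))" by (rule ideal_pow_mult[OF x(3) Jw[OF x(2)]])
      moreover have "b * (a * w) = x * w" by (simp add: x(1) ac_simps)
      moreover have "i' + Suc (Suc p) = Suc (i + p)" using i by simp
      ultimately show "x \<in> {x. \<forall>y\<in>{w}. x * y \<in> ?I (Suc (i + p))}" by (simp only: mem_Collect_eq ball_simps)
    qed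
    then show ?thesis using that(1) i by blast
  qed
  obtain f where f: "gr_rep J f" "f 0 \<in> max_ideal"
    and reg: "\<And>g. gr_rep J g \<Longrightarrow> gr_zero J (gr_mult f g) \<Longrightarrow> gr_zero J g"
    using depth unfolding gr_depth_pos_def gr_max_ideal_elem_def by blast
  have "(max_ideal :: ('v, 'k) mpoly set) \<subseteq> {x. \<forall>y\<in>{w}. x * y \<in> ?I (Suc p)}"
    unfolding max_ideal_def
  proof (rule ideal_gen_minimal[OF colon], rule subsetI)
    fix x :: "('v, 'k) mpoly" assume "x \<in> range var"
    then obtain v where "x = mon (Poly_Mapping.single v 1)" by (auto simp: var_def)
    moreover have "Poly_Mapping.single v (1::nat) \<noteq> 0"
      by (metis lookup_single_eq lookup_zero zero_neq_one)
    ultimately show "x \<in> {x. \<forall>y\<in>{w}. x * y \<in> ?I (Suc p)}" using m(2) by (simp add: w_def)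
  qed
  then have f0: "f 0 * w \<in> ?I (Suc p)" using f(2) by blast
  have fw: "f i * w \<in> ?I (Suc (i + p))" for i
    using f0 IJw[of "f i" i] f(1) by (cases "i = 0") (auto simp: gr_rep_def)
  \<comment> \<open>The family concentrated in degree \<open>p\<close> with entry \<open>w\<close>
    is nonzero in the graded ring, yet \<open>f\<close> annihilates it.\<close>
  define g where "g i = (if i = p then w else 0)" for i
  have "gr_rep J g"
    unfolding gr_rep_def g_def using wp is_idealD(1)[OF id] by auto
  moreover have "gr_zero J (gr_mult f g)"
    unfolding gr_zero_def
  proof
    fix i show "gr_mult f g i \<in> ?I (Suc i)"
      unfolding gr_mult_def
    proof (rule is_ideal_sum[OF id])
      fix j assume "j \<in> {..i}"
      then show "f j * g (i - j) \<in> ?I (Suc i)"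
        using fw[of j] is_idealD(1)[OF id] by (cases "i - j = p") (auto simp: g_def simp del: ideal_pow.simps)
    qed
  qed
  ultimately have "g p \<in> ?I (Suc p)" using reg unfolding gr_zero_def by blast
  then show False using m(1) by (simp add: g_def w_def)
qed

text \<open>An element of \<open>U\<close> that leaves the box of side \<open>Max (range N)\<close>
  is a multiple of a pure power inside that box, so the part of \<open>U\<close> in the box
  generates.\<close>

lemma ex_finite_generators:
  fixes U :: "('v::finite \<Rightarrow>\<^sub>0 nat) set"
  assumes U: "upset U" and N: "\<And>v. Poly_Mapping.single v (N v) \<in> U"
  obtains S where "finite S" "S \<subseteq> U" "\<And>u. u \<in> U \<Longrightarrow> \<exists>s\<in>S. \<exists>a. u = a + s"
proof
  let ?K = "Max (range N)"
  let ?S = "{m \<in> U. \<forall>v. lookup m v \<le> ?K}"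
  show "finite ?S"
    by (rule finite_subset[OF _ finite_bounded_monomials[of "\<lambda>_. ?K"]]) auto
  show "?S \<subseteq> U" by auto
  fix u assume u: "u \<in> U"
  show "\<exists>s\<in>?S. \<exists>a. u = a + s"
  proof (cases "\<forall>v. lookup u v \<le> ?K")
    case True
    then show ?thesis using u by (intro bexI[of _ u] exI[of _ 0]) auto
  next
    case False
    then obtain v where v: "?K < lookup u v" by (auto simp: not_le)
    have NK: "N v \<le> ?K" by simp
    let ?s = "Poly_Mapping.single v (N v)"
    have "u = (u - ?s) + ?s"
    proof (rule poly_mapping_eqI)
      have "N v \<le> lookup u v" using v NK by linarith
      then show "lookup u k = lookup (u - ?s + ?s) k" for k
        by (auto simp: lookup_add lookup_minus lookup_single when_def)
    qed
    moreover have "?s \<in> ?S" using N NK by (auto simp: lookup_single when_def)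
    ultimately show ?thesis by blast
  qed
qed

context monomial_order
begin

text \<open>A variant of McCoy's argument: multiplying \<open>g\<close> by the leading offending generator and
  dropping its leading term gives a counterexample with fewer terms.\<close>
lemma mult_sum_generators_regular:
  fixes g :: "('v, 'k::field) mpoly"
  assumes S: "finite S" "S \<subseteq> U" and gen: "\<And>u. u \<in> U \<Longrightarrow> \<exists>s\<in>S. \<exists>a. u = a + s"
    and colon: "\<And>n u. (\<And>s. s \<in> U \<Longrightarrow> s + u \<in> monom_pow U (Suc n)) \<Longrightarrow> u \<in> monom_pow U n"
    and fg: "(\<Sum>s\<in>S. mon s) * g \<in> mon_span (monom_pow U (Suc n))"
  shows "g \<in> mon_span (monom_pow U n)"
  using fg
proof (induction "card (keys g)" arbitrary: g n rule: less_induct)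
  case less
  let ?M = "\<lambda>n. mon_span (monom_pow U n) :: ('v, 'k) mpoly set"
  define f :: "('v, 'k) mpoly" where "f = (\<Sum>s\<in>S. mon s)"
  have M: "is_subspace (?M n)" for n by (rule is_subspace_mon_span)
  have fU: "f \<in> mon_span U" unfolding f_def using S(2) by (intro is_subspace_sum is_subspace_mon_span) auto
  have mulU: "a * b \<in> ?M (Suc n)" if "a \<in> mon_span U" "b \<in> ?M n" for a b n
    by (rule mon_span_mult[OF that]) auto
  show ?case
  proof (rule ccontr)
    assume g: "g \<notin> ?M n"
    \<comment> \<open>The offending generators. If there were none, every exponent of
      \<open>g\<close> would satisfy the premise of \<open>colon\<close>.\<close>
    define B where "B = {s \<in> S. mon s * g \<notin> ?M (Suc n)}"
    have "B \<noteq> {}"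
    proof
      assume "B = {}"
      then have B: "mon s * g \<in> ?M (Suc n)" if "s \<in> S" for s using that by (auto simp: B_def)
      have "keys g \<subseteq> monom_pow U n"
      proof
        fix u assume u: "u \<in> keys g"
        show "u \<in> monom_pow U n"
        proof (rule colon)
          fix s assume "s \<in> U"
          then obtain s0 a where s: "s0 \<in> S" "s = a + s0" using gen by blast
          have "s0 + u \<in> keys (mon s0 * g)" using u by (simp add: in_keys_iff lookup_single_mult)
          then have "s0 + u \<in> monom_pow U (Suc n)" using B[OF s(1)] by (auto simp: mon_span_def)
          then have "a + (s0 + u) \<in> monom_pow U (Suc n)" using upset_monom_pow[of U "Suc n"] unfolding upset_def by blast
          then show "s + u \<in> monom_pow U (Suc n)" by (simp only: s(2) add.assoc)
        qed
      qed
      then show False using g by (simp add: mon_span_def)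
    qed
    moreover have "finite B" using S(1) by (simp add: B_def)
    ultimately obtain s where sB: "s \<in> B" "\<And>t. t \<in> B \<Longrightarrow> le t s" using ex_max[of B] by blast
    have s: "s \<in> S" "mon s * g \<notin> ?M (Suc n)" using sB(1) by (auto simp: B_def)
    \<comment> \<open>Generators beyond the largest offender \<open>s\<close> multiply
      \<open>g\<close> into \<open>?M (Suc n)\<close>, so they can be removed from \<open>f\<close>;
      what remains has leading exponent \<open>s\<close>.\<close>
    define f' :: "('v, 'k) mpoly" where "f' = (\<Sum>t\<in>{t \<in> S. le t s}. mon t)"
    have lk: "lookup f' x = (if x \<in> S \<and> le x s then 1 else 0)" for x
      using S(1) by (simp add: f'_def lookup_sum lookup_single when_def)
    have key_s: "s \<in> keys f'" using s(1) by (simp add: in_keys_iff lk)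
    have lead_f': "lead_monom le f' = s"
      by (rule lead_monom_eqI[OF key_s]) (auto simp: in_keys_iff lk split: if_splits)
    have f'0: "f' \<noteq> 0" using key_s by auto
    have g0: "g \<noteq> 0" using g is_subspaceD(1)[OF M, of n] by metis
    have "f = f' + (\<Sum>t\<in>{t \<in> S. \<not> le t s}. mon t)"
      unfolding f_def f'_def using S(1)
      by (subst sum.union_disjoint[symmetric]) (auto intro: sum.cong)
    then have eq: "f' * g = f * g - (\<Sum>t\<in>{t \<in> S. \<not> le t s}. mon t * g)"
      by (simp add: algebra_simps sum_distrib_left)
    have rest: "(\<Sum>t\<in>{t \<in> S. \<not> le t s}. mon t * g) \<in> ?M (Suc n)"
      by (rule is_subspace_sum[OF M]) (use sB in \<open>auto simp: B_def\<close>)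
    have fg: "f * g \<in> ?M (Suc n)" using less.prems by (simp only: f_def)
    have "f' * g \<in> ?M (Suc n)" unfolding eq by (rule is_subspaceD(4)[OF M fg rest])
    moreover have "s + lead_monom le g \<in> keys (f' * g)"
      using mult_ne_0_lead_monom[OF f'0 g0] lead_monom(1)[of "f' * g"] lead_f' by simp
    \<comment> \<open>A monomial span contains each monomial of its elements, in particular the
      leading one, so the leading term of \<open>mon s * g\<close> can be split off.\<close>
    ultimately have sl: "s + lead_monom le g \<in> monom_pow U (Suc n)" by (auto simp: mon_span_def)
    define c where "c = lookup g (lead_monom le g)"
    define g1 where "g1 = g - Poly_Mapping.single (lead_monom le g) c"
    define g' where "g' = mon s * g1"
    define r where "r = Poly_Mapping.single (s + lead_monom le g) c"
    have sg: "mon s * g = g' + r"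
      by (simp add: g'_def g1_def r_def algebra_simps mult_single)
    have "keys g1 \<subseteq> keys g - {lead_monom le g}"
      by (auto simp: g1_def c_def in_keys_iff lookup_minus lookup_single when_def split: if_splits)
    then have "card (keys g1) < card (keys g)"
      using lead_monom(1)[OF g0] by (intro psubset_card_mono) auto
    moreover have "card (keys g') \<le> card (keys g1)"
      unfolding g'_def using keys_single_mult_subset[of s "1::'k" g1] by (rule surj_card_le[OF finite_keys])
    ultimately have card: "card (keys g') < card (keys g)" by simp
    have r: "r \<in> ?M (Suc n)" using sl by (simp add: r_def mon_span_def)
    have 1: "mon s * (f * g) \<in> ?M (Suc (Suc n))"
      by (rule mulU[OF _ fg]) (use s(1) S(2) in auto)
    have 2: "f * r \<in> ?M (Suc (Suc n))" by (rule mulU[OF fU r])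
    have eq': "f * g' = mon s * (f * g) - f * r"
    proof -
      have "mon s * (f * g) = f * (mon s * g)" by (simp only: mult.left_commute)
      also have "\<dots> = f * g' + f * r" by (simp only: sg distrib_left)
      finally show ?thesis by simp
    qed
    have "f * g' \<in> ?M (Suc (Suc n))" unfolding eq' by (rule is_subspaceD(4)[OF M 1 2])
    \<comment> \<open>The induction hypothesis is applied with \<open>Suc n\<close> in place of
      \<open>n\<close>, since multiplication by \<open>mon s\<close> raises the power by
      one.\<close>
    then have "g' \<in> ?M (Suc n)" using less.hyps[OF card] by (simp only: f_def)
    then have "mon s * g \<in> ?M (Suc n)" unfolding sg using r by (rule is_subspaceD(2)[OF M])
    with s(2) show False by simp
  qed
qed

section \<open>The gap between the powers of \<open>in(I)\<close> and the initial ideals of the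
  powers of \<open>I\<close>\<close>

lemma initial_ideal_eq:
  assumes "is_ideal (I :: ('v, 'k::idom) mpoly set)"
  shows "initial_ideal le I = mon_span (lead_monoms I)"
proof -
  have "{mon (lead_monom le f) | f. f \<in> I \<and> f \<noteq> 0} = (mon ` lead_monoms I :: ('v, 'k) mpoly set)"
    by (auto simp: lead_monoms_def)
  then show ?thesis
    unfolding initial_ideal_def by (simp add: mon_span_eq_ideal_gen[OF upset_lead_monoms[OF assms]])
qed

lemma monom_pow_lead_monoms_subset: "monom_pow (lead_monoms I) n \<subseteq> lead_monoms (ideal_pow (I :: ('v, 'k::idom) mpoly set) n)"
proof (induction n)
  case 0
  show ?case using mon_in_lead_monoms[of _ "UNIV :: ('v, 'k) mpoly set"] by auto
next
  case (Suc n)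
  have "a + b \<in> lead_monoms (ideal_pow I (Suc n))" if "a \<in> lead_monoms I" "b \<in> lead_monoms (ideal_pow I n)" for a b
    using ideal_pow_Suc_mult that by (rule lead_monoms_add)
  then show ?case using Suc unfolding monom_pow.simps by blast
qed

text \<open>Over a field the complement of the leading monomials counts the dimension of the
  quotient, so this is additivity of dimension along consecutive powers.\<close>

lemma card_lead_monoms_ideal_pow_diff:
  fixes I :: "('v, 'k::comm_ring_1) mpoly set"
  assumes "cofinite_monomials (ideal_pow I (Suc n))"
  shows "card (- lead_monoms (ideal_pow I (Suc n))) =
    card (- lead_monoms (ideal_pow I n)) + card (lead_monoms (ideal_pow I n) - lead_monoms (ideal_pow I (Suc n)))"
proof -
  let ?A = "lead_monoms (ideal_pow I (Suc n))" and ?B = "lead_monoms (ideal_pow I n)"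
  have sub: "?A \<subseteq> ?B" by (intro lead_monoms_mono ideal_pow_Suc_subset)
  have fin: "finite (- ?A)" by (rule finite_compl_lead_monoms[OF assms])
  have "- ?A = - ?B \<union> (?B - ?A)" using sub by blast
  moreover have "finite (- ?B)" "finite (?B - ?A)"
    using fin sub by (auto elim: finite_subset[rotated])
  moreover have "- ?B \<inter> (?B - ?A) = {}" by blast
  ultimately show ?thesis by (metis card_Un_disjoint)
qed

text \<open>The monomials counted on the left form a basis of in(I^n)/J^n. Their products with the
  sum of the generators need not be monomials, so they are compared with the right side through the
  leading monomials of the space they span.\<close>

lemma card_lead_monoms_diff_monom_pow_mono:
  fixes I :: "('v, 'k::field) mpoly set"
  assumes I: "is_ideal I" and cof: "\<And>n. cofinite_monomials (ideal_pow (mon_span (lead_monoms I) :: ('v, 'k) mpoly set) n)"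
    and S: "finite S" "S \<subseteq> lead_monoms I" and gen: "\<And>u. u \<in> lead_monoms I \<Longrightarrow> \<exists>s\<in>S. \<exists>a. u = a + s"
    and depth: "gr_depth_pos (mon_span (lead_monoms I) :: ('v, 'k) mpoly set)"
  shows "card (lead_monoms (ideal_pow I n) - monom_pow (lead_monoms I) n) \<le>
    card (lead_monoms (ideal_pow I (Suc n)) - monom_pow (lead_monoms I) (Suc n))"
proof -
  let ?U = "lead_monoms I"
  let ?X = "lead_monoms (ideal_pow I n) - monom_pow ?U n"
  let ?A = "mon_span (monom_pow ?U (Suc n)) :: ('v, 'k) mpoly set"
  let ?B = "mon_span (lead_monoms (ideal_pow I (Suc n))) :: ('v, 'k) mpoly set"
  define f :: "('v, 'k) mpoly" where "f = (\<Sum>s\<in>S. mon s)"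
  define e where "e x = f * mon x" for x
  have U: "upset ?U" by (rule upset_lead_monoms[OF I])
  have cofM: "cofinite_monomials (mon_span (monom_pow ?U k) :: ('v, 'k) mpoly set)" for k
    using cof[of k] by (simp only: ideal_pow_mon_span[OF U])
  have "- monom_pow ?U k = - lead_monoms (mon_span (monom_pow ?U k) :: ('v, 'k) mpoly set)" for k by simp
  then have fin: "finite (- monom_pow ?U k)" for k
    using finite_compl_lead_monoms[OF cofM[of k]] by simp
  have finX: "finite ?X" by (rule finite_subset[OF _ fin[of n]]) auto
  have "c x = 0" if c: "(\<Sum>x\<in>?X. cst (c x) * e x) \<in> ?A" and x: "x \<in> ?X" for c x
  proof -
    \<comment> \<open>The coefficients of a relation are assembled into one polynomial supported on
      \<open>?X\<close>. Regularity puts its exponents into \<open>monom_pow ?U n\<close>, which is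
      disjoint from \<open>?X\<close>, so they all vanish.\<close>
    define g where "g = (\<Sum>x\<in>?X. Poly_Mapping.single x (c x))"
    have "(\<Sum>x\<in>?X. cst (c x) * e x) = f * g"
      unfolding e_def g_def sum_distrib_left
      by (rule sum.cong[OF refl]) (simp add: mult.left_commute mult_single)
    then have fg: "f * g \<in> ?A" using c by simp
    have "g \<in> mon_span (monom_pow ?U n)"
    proof (rule mult_sum_generators_regular[OF S gen])
      show "u \<in> monom_pow ?U k" if "\<And>s. s \<in> ?U \<Longrightarrow> s + u \<in> monom_pow ?U (Suc k)" for k u
        using that by (rule gr_depth_pos_colon[OF U refl depth cof])
      show "(\<Sum>s\<in>S. mon s) * g \<in> ?A" using fg by (simp only: f_def)
    qed
    then have "x \<notin> keys g" using x by (auto simp: mon_span_def)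
    moreover have "lookup g x = c x"
      using x finX by (simp add: g_def lookup_sum lookup_single when_def)
    ultimately show ?thesis by (simp add: in_keys_iff)
  qed
  then have card: "card (lead_monoms (span_over ?A e ?X) - lead_monoms ?A) = card ?X"
    using card_lead_monoms_span_over_independent[OF finX is_subspace_mon_span cofM] by blast
  have "f \<in> mon_span ?U" unfolding f_def using S(2) by (intro is_subspace_sum is_subspace_mon_span) auto
  then have "e x \<in> ?B" if "x \<in> ?X" for x
    unfolding e_def
  proof (rule mon_span_mult)
    show "mon x \<in> mon_span (lead_monoms (ideal_pow I n))" using that by simp
    show "a + b \<in> lead_monoms (ideal_pow I (Suc n))" if "a \<in> ?U" "b \<in> lead_monoms (ideal_pow I n)" for a b
      using ideal_pow_Suc_mult that by (rule lead_monoms_add)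
  qed
  then have "span_over ?A e ?X \<subseteq> ?B"
    by (intro span_over_subset is_subspace_mon_span mon_span_mono monom_pow_lead_monoms_subset)
  then have "lead_monoms (span_over ?A e ?X) \<subseteq> lead_monoms ?B" by (rule lead_monoms_mono)
  then have "lead_monoms (span_over ?A e ?X) - lead_monoms ?A \<subseteq> lead_monoms (ideal_pow I (Suc n)) - monom_pow ?U (Suc n)"
    unfolding lead_monoms_mon_span by blast
  moreover have "finite (lead_monoms (ideal_pow I (Suc n)) - monom_pow ?U (Suc n))"
    by (rule finite_subset[OF _ fin[of "Suc n"]]) auto
  ultimately show ?thesis unfolding card[symmetric] by (rule card_mono[rotated])
qed

end

theorem theorem2p4:
  fixes I :: "('v::finite, 'k::{alg_closed_field, field_char_0}) mpoly set"
    and le :: "('v \<Rightarrow>\<^sub>0 nat) \<Rightarrow> ('v \<Rightarrow>\<^sub>0 nat) \<Rightarrow> bool"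
  assumes "term_order le"
    and "m_primary I"
  shows "(\<exists>n0. \<forall>n\<ge>n0. HF I n \<le> HF (initial_ideal le I) n) \<and>
         (gr_depth_pos (initial_ideal le I) \<longrightarrow> (\<forall>n. HF I n \<le> HF (initial_ideal le I) n))"
proof -
  interpret monomial_order le by unfold_locales (rule assms)
  let ?J = "initial_ideal le I"
  have I: "is_ideal I" using assms(2) by (simp add: m_primary_def primary_ideal_def)
  \<comment> \<open>All finiteness comes from the powers of the variables that the radical condition
    places in \<open>I\<close>.\<close>
  have "var v \<in> ideal_radical I" for v
    using assms(2) ideal_gen_superset[of "range var"] unfolding m_primary_def max_ideal_def by auto
  then have "\<exists>n. var v ^ n \<in> I" for v by (simp add: ideal_radical_def)
  then obtain N where N: "\<And>v. var v ^ N v \<in> I" by metis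
  have J: "?J = mon_span (lead_monoms I)" by (rule initial_ideal_eq[OF I])
  have U: "upset (lead_monoms I)" by (rule upset_lead_monoms[OF I])
  have NU: "Poly_Mapping.single v (N v) \<in> lead_monoms I" for v
    using N[of v] by (intro mon_in_lead_monoms[where 'k = 'k]) (simp add: var_power)
  then have NJ: "var v ^ N v \<in> ?J" for v by (simp add: J var_power)
  have idJ: "is_ideal ?J" unfolding J by (rule is_ideal_mon_span[OF U])
  have cI: "cofinite_monomials (ideal_pow I n)" for n using N by (rule cofinite_monomials_ideal_pow)
  have cJ: "cofinite_monomials (ideal_pow ?J n)" for n using NJ by (rule cofinite_monomials_ideal_pow)
  have lead_monomsJ: "lead_monoms (ideal_pow ?J n) = monom_pow (lead_monoms I) n" for n
    unfolding J ideal_pow_mon_span[OF U] by simp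
  \<comment> \<open>In this form the increments of \<open>q\<close> become differences of Hilbert
    functions; the count proved next shows that \<open>q\<close> is nonnegative.\<close>
  define q where "q n = int (card (- lead_monoms (ideal_pow ?J n))) - int (card (- lead_monoms (ideal_pow I n)))" for n
  have q: "q n = int (card (lead_monoms (ideal_pow I n) - monom_pow (lead_monoms I) n))" for n
  proof -
    have "- monom_pow (lead_monoms I) n = - lead_monoms (ideal_pow I n) \<union> (lead_monoms (ideal_pow I n) - monom_pow (lead_monoms I) n)"
      using monom_pow_lead_monoms_subset[of I n] by blast
    moreover have "finite (- lead_monoms (ideal_pow I n))" by (rule finite_compl_lead_monoms[OF cI])
    moreover have "finite (lead_monoms (ideal_pow I n) - monom_pow (lead_monoms I) n)"
      using finite_compl_lead_monoms[OF cJ[of n]] unfolding lead_monomsJ by (rule finite_subset[rotated]) auto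
    moreover have "- lead_monoms (ideal_pow I n) \<inter> (lead_monoms (ideal_pow I n) - monom_pow (lead_monoms I) n) = {}" by blast
    ultimately have "card (- monom_pow (lead_monoms I) n) =
        card (- lead_monoms (ideal_pow I n)) + card (lead_monoms (ideal_pow I n) - monom_pow (lead_monoms I) n)"
      by (metis card_Un_disjoint)
    then show ?thesis unfolding q_def lead_monomsJ by simp
  qed
  have dq: "q (Suc n) - q n = int (card (lead_monoms (ideal_pow ?J n) - lead_monoms (ideal_pow ?J (Suc n)))) -
      int (card (lead_monoms (ideal_pow I n) - lead_monoms (ideal_pow I (Suc n))))" for n
    using card_lead_monoms_ideal_pow_diff[OF cI, of n] card_lead_monoms_ideal_pow_diff[OF cJ, of n]
    unfolding q_def by linarith
  have HF: "HF I n \<le> HF ?J n \<longleftrightarrow> q n \<le> q (Suc n)" for n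
    using dq[of n] unfolding HF_eq[OF cI] HF_eq[OF cJ] enat_ord_simps by linarith
  have "eventually_poly (\<lambda>n. q (Suc n) - q n)"
    unfolding dq using eventually_poly_card_lead_monoms_var_powers[OF idJ NJ] eventually_poly_card_lead_monoms_var_powers[OF I N]
    by (rule eventually_poly_diff)
  then have "\<forall>\<^sub>F n in sequentially. q n \<le> q (Suc n)"
    by (rule eventually_poly_increments_nonneg) (simp add: q)
  moreover have "q n \<le> q (Suc n)" if depth: "gr_depth_pos ?J" for n
  proof -
    obtain S where S: "finite S" "S \<subseteq> lead_monoms I" "\<And>u. u \<in> lead_monoms I \<Longrightarrow> \<exists>s\<in>S. \<exists>a. u = a + s"
      using ex_finite_generators[OF U NU] by metis
    show ?thesis unfolding q of_nat_le_iff
      by (rule card_lead_monoms_diff_monom_pow_mono[OF I cJ[unfolded J] S depth[unfolded J]])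
  qed
  ultimately show ?thesis unfolding HF eventually_sequentially by blast
qed

end
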